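(* Let $e\geq 2$ be an integer. Let $K$ be a finite commutative ring with identity having precisely three ideals: $\langle 0\rangle$, $J$ and $K$. Let $K/J\cong \mathbb{F}_q$, where $\mathbb{F}_q$ is a finite field of order $q$ for a prime power $q$. Then the graph $X(2e,K)$ is a divisible design graph with parameters $(v,k,\lambda_1,\lambda_2,m,n)$ where $v=\frac{q^{2e-1}(q^{2e}-1)}{q-1}$, $k=q^{4e-2}+q^{4e-3}-q^{2e-2}$, $\lambda_1=q^{4e-2}+q^{4e-3}-q^{4e-4}-q^{2e-2}$, $\lambda_2=q^{4e-2}+q^{4e-3}-q^{4e-4}-q^{4e-5}-q^{2e-2}+q^{2e-3}$, $m=\frac{q^{2e}-1}{q-1}$, $n=q^{2e-1}$.
   Context: A divisible design graph with parameters $(v,k,\lambda_1,\lambda_2,m,n)$ is a $k$-regular graph on $v$ vertices whose vertex set can be partitioned into $m$ classes of size $n$ such that any two distinct vertices in the same class have exactly $\lambda_1$ common neighbours and any two vertices in different classes have exactly $\lambda_2$ common neighbours. Let $K^\times$ be the set of units of $K$. Let $V'$ be the set of tuples $(a_1,\ldots,a_{2e})\in K^{2e}$ having at least one entry in $K^\times$. Two tuples $a,b\in V'$ are equivalent if $a=\lambda b$ for some $\lambda\in K^\times$; write $[a]$ for the class of $a$ and let $V$ be the set of classes. For $a,b\in K^{2e}$ put $\langle a,b\rangle=\sum_{i=1}^{e}(a_ib_{e+i}-a_{e+i}b_i)$ (i.e. $aMb^t$ with $M=\begin{bmatrix}0&I_e\\-I_e&0\end{bmatrix}$). The graph $X(2e,K)$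 has vertex set $V$, with $[a]$ adjacent to $[b]$ iff $\langle a,b\rangle\in K\setminus\{0\}$. *)

theory Defs
  imports
    "HOL-Algebra.QuotRing"
    "HOL-Number_Theory.Prime_Powers"
    "Graph_Theory.Pair_Digraph"
begin

text \<open>
  Finite simple undirected graphs are the finite, loop-free, symmetric pair digraphs of
  locale \<^locale>\<open>pair_graph\<close>.
\<close>

definition neighbours :: "'a pair_pre_digraph \<Rightarrow> 'a \<Rightarrow> 'a set" where
  "neighbours G x = {z \<in> pverts G. (x, z) \<in> parcs G}"

definition common_neighbours :: "'a pair_pre_digraph \<Rightarrow> 'a \<Rightarrow> 'a \<Rightarrow> 'a set" where
  "common_neighbours G x y = neighbours G x \<inter> neighbours G y"

definition regular_graph :: "'a pair_pre_digraph \<Rightarrow> nat \<Rightarrow> bool" where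
  "regular_graph G k \<longleftrightarrow> pair_graph G \<and> (\<forall>x \<in> pverts G. card (neighbours G x) = k)"

definition divisible_design_graph ::
    "'a pair_pre_digraph \<Rightarrow> nat \<Rightarrow> nat \<Rightarrow> nat \<Rightarrow> nat \<Rightarrow> nat \<Rightarrow> nat \<Rightarrow> bool" where
  "divisible_design_graph G v k l1 l2 m n \<longleftrightarrow>
     regular_graph G k \<and> card (pverts G) = v \<and>
     (\<exists>P. partition_on (pverts G) P \<and> card P = m \<and> (\<forall>C \<in> P. card C = n) \<and>
       (\<forall>C \<in> P. \<forall>x \<in> C. \<forall>y \<in> C. x \<noteq> y \<longrightarrow> card (common_neighbours G x y) = l1) \<and>
       (\<forall>C \<in> P. \<forall>D \<in> P. C \<noteq> D \<longrightarrow>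
          (\<forall>x \<in> C. \<forall>y \<in> D. card (common_neighbours G x y) = l2)))"

text \<open>Tuples in $K^{2e}$ are extensional functions on the index set \<open>{1..2 * e}\<close>.\<close>

definition unit_tuples :: "nat \<Rightarrow> ('a, 'b) ring_scheme \<Rightarrow> (nat \<Rightarrow> 'a) set" where
  "unit_tuples e K =
     {a \<in> {1..2 * e} \<rightarrow>\<^sub>E carrier K. \<exists>i \<in> {1..2 * e}. a i \<in> Units K}"

definition tuple_rel :: "nat \<Rightarrow> ('a, 'b) ring_scheme \<Rightarrow> (nat \<Rightarrow> 'a) rel" where
  "tuple_rel e K =
     {(a, b) \<in> unit_tuples e K \<times> unit_tuples e K.
        \<exists>c \<in> Units K. \<forall>i \<in> {1..2 * e}. a i = c \<otimes>\<^bsub>K\<^esub> b i}"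

abbreviation tuple_class :: "nat \<Rightarrow> ('a, 'b) ring_scheme \<Rightarrow> (nat \<Rightarrow> 'a) \<Rightarrow> (nat \<Rightarrow> 'a) set" where
  "tuple_class e K a \<equiv> tuple_rel e K `` {a}"

definition symp_form ::
    "nat \<Rightarrow> ('a, 'b) ring_scheme \<Rightarrow> (nat \<Rightarrow> 'a) \<Rightarrow> (nat \<Rightarrow> 'a) \<Rightarrow> 'a" where
  "symp_form e K a b =
     (\<Oplus>\<^bsub>K\<^esub>i \<in> {1..e}. a i \<otimes>\<^bsub>K\<^esub> b (e + i) \<ominus>\<^bsub>K\<^esub> a (e + i) \<otimes>\<^bsub>K\<^esub> b i)"

text \<open>
  The graph $X(2e,K)$; adjacency does not depend on the chosen representatives, see
  \<open>symp_graph_adj_iff\<close> below.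
\<close>

definition symp_graph :: "nat \<Rightarrow> ('a, 'b) ring_scheme \<Rightarrow> (nat \<Rightarrow> 'a) set pair_pre_digraph" where
  "symp_graph e K =
     \<lparr>pverts = unit_tuples e K // tuple_rel e K,
      parcs = {(tuple_class e K a, tuple_class e K b) | a b.
                 a \<in> unit_tuples e K \<and> b \<in> unit_tuples e K \<and>
                 symp_form e K a b \<in> carrier K - {\<zero>\<^bsub>K\<^esub>}}\<rparr>"

context cring
begin

lemma unit_tuples_carrier: "a \<in> unit_tuples e R \<Longrightarrow> i \<in> {1..2 * e} \<Longrightarrow> a i \<in> carrier R"
  by (auto simp: unit_tuples_def)

lemma equiv_tuple_rel: "equiv (unit_tuples e R) (tuple_rel e R)"
proof (rule equivI)
  show "tuple_rel e R \<subseteq> unit_tuples e R \<times> unit_tuples e R"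
    by (auto simp: tuple_rel_def)
  show "refl_on (unit_tuples e R) (tuple_rel e R)"
    by (rule refl_onI) (auto simp: tuple_rel_def unit_tuples_carrier intro!: bexI[of _ \<one>])
  show "sym (tuple_rel e R)"
  proof (rule symI)
    fix a b assume "(a, b) \<in> tuple_rel e R"
    then obtain c where ab: "a \<in> unit_tuples e R" "b \<in> unit_tuples e R" and c: "c \<in> Units R"
      and eq: "\<And>i. i \<in> {1..2 * e} \<Longrightarrow> a i = c \<otimes> b i"
      by (auto simp: tuple_rel_def)
    have "b i = inv c \<otimes> a i" if "i \<in> {1..2 * e}" for i
      using eq[OF that] unit_tuples_carrier[OF ab(2) that] c
      by (simp add: m_assoc[symmetric] Units_closed)
    then show "(b, a) \<in> tuple_rel e R"
      using ab c by (auto simp: tuple_rel_def intro!: bexI[of _ "inv c"])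
  qed
  show "trans (tuple_rel e R)"
  proof (rule transI)
    fix a b d assume "(a, b) \<in> tuple_rel e R" "(b, d) \<in> tuple_rel e R"
    then obtain c c' where ad: "a \<in> unit_tuples e R" "d \<in> unit_tuples e R"
      and c: "c \<in> Units R" "c' \<in> Units R"
      and eq: "\<And>i. i \<in> {1..2 * e} \<Longrightarrow> a i = c \<otimes> b i" "\<And>i. i \<in> {1..2 * e} \<Longrightarrow> b i = c' \<otimes> d i"
      by (auto simp: tuple_rel_def)
    have "a i = (c \<otimes> c') \<otimes> d i" if "i \<in> {1..2 * e}" for i
      using eq[OF that] unit_tuples_carrier[OF ad(2) that] c
      by (simp add: m_assoc Units_closed)
    then show "(a, d) \<in> tuple_rel e R"
      using ad c by (auto simp: tuple_rel_def intro!: bexI[of _ "c \<otimes> c'"])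
  qed
qed

lemma symp_form_closed:
  assumes "a \<in> unit_tuples e R" "b \<in> unit_tuples e R"
  shows "symp_form e R a b \<in> carrier R"
  unfolding symp_form_def
  by (intro finsum_closed) (auto simp: unit_tuples_carrier[OF assms(1)] unit_tuples_carrier[OF assms(2)])

lemma symp_form_scale:
  assumes a: "a \<in> unit_tuples e R" and b: "b \<in> unit_tuples e R"
    and c: "c \<in> carrier R" "d \<in> carrier R"
    and eq: "\<And>i. i \<in> {1..2 * e} \<Longrightarrow> a' i = c \<otimes> a i" "\<And>i. i \<in> {1..2 * e} \<Longrightarrow> b' i = d \<otimes> b i"
  shows "symp_form e R a' b' = (c \<otimes> d) \<otimes> symp_form e R a b"
proof -
  note cl = unit_tuples_carrier[OF a] unit_tuples_carrier[OF b]
  have "symp_form e R a' b' =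
      (\<Oplus>i \<in> {1..e}. (c \<otimes> d) \<otimes> (a i \<otimes> b (e + i) \<ominus> a (e + i) \<otimes> b i))"
    unfolding symp_form_def
  proof (rule finsum_cong')
    fix i assume "i \<in> {1..e}"
    then have i: "i \<in> {1..2 * e}" "e + i \<in> {1..2 * e}" by auto
    show "a' i \<otimes> b' (e + i) \<ominus> a' (e + i) \<otimes> b' i =
        (c \<otimes> d) \<otimes> (a i \<otimes> b (e + i) \<ominus> a (e + i) \<otimes> b i)"
      unfolding eq(1)[OF i(1)] eq(1)[OF i(2)] eq(2)[OF i(1)] eq(2)[OF i(2)]
      using c cl(1)[OF i(1)] cl(1)[OF i(2)] cl(2)[OF i(1)] cl(2)[OF i(2)] by algebra
  qed (use c cl in auto)
  also have "\<dots> = (c \<otimes> d) \<otimes> symp_form e R a b"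
    unfolding symp_form_def by (rule finsum_rdistr[symmetric]) (use c cl in auto)
  finally show ?thesis .
qed

lemma symp_graph_adj_iff:
  assumes a: "a \<in> unit_tuples e R" and b: "b \<in> unit_tuples e R"
  shows "(tuple_class e R a, tuple_class e R b) \<in> parcs (symp_graph e R) \<longleftrightarrow>
    symp_form e R a b \<in> carrier R - {\<zero>}"
proof
  assume "(tuple_class e R a, tuple_class e R b) \<in> parcs (symp_graph e R)"
  then obtain a' b' where a': "a' \<in> unit_tuples e R" and b': "b' \<in> unit_tuples e R"
    and nz: "symp_form e R a' b' \<noteq> \<zero>"
    and cls: "tuple_class e R a = tuple_class e R a'" "tuple_class e R b = tuple_class e R b'"
    by (auto simp: symp_graph_def)
  have "(a', a) \<in> tuple_rel e R" "(b', b) \<in> tuple_rel e R"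
    using eq_equiv_class[OF cls(1)[symmetric] equiv_tuple_rel a]
      eq_equiv_class[OF cls(2)[symmetric] equiv_tuple_rel b] by auto
  then obtain c d where c: "c \<in> Units R" "d \<in> Units R"
    and eq: "\<And>i. i \<in> {1..2 * e} \<Longrightarrow> a' i = c \<otimes> a i" "\<And>i. i \<in> {1..2 * e} \<Longrightarrow> b' i = d \<otimes> b i"
    by (auto simp: tuple_rel_def)
  have "symp_form e R a' b' = (c \<otimes> d) \<otimes> symp_form e R a b"
    by (rule symp_form_scale[OF a b]) (use c eq in auto)
  then have "symp_form e R a b \<noteq> \<zero>" using nz c by (auto simp: Units_closed)
  then show "symp_form e R a b \<in> carrier R - {\<zero>}" using symp_form_closed[OF a b] by simp
qed (use a b in \<open>auto simp: symp_graph_def\<close>)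

end

end

theory Submission
  imports Defs "HOL-Algebra.Product_Groups"
begin

text \<open>
  The ring \<open>K\<close> is local with maximal ideal \<open>J\<close>, principal with \<open>J\<^sup>2 = 0\<close>, so \<open>|J| = q\<close> and
  \<open>|K| = q\<^sup>2\<close>. A projective class is an orbit of the free action of the \<open>q\<^sup>2 - q\<close> units, so every count
  of vertices is a count of tuples in \<open>K\<^bsup>2e\<^esup> - J\<^bsup>2e\<^esup>\<close> divided by \<open>q\<^sup>2 - q\<close>. The tuples orthogonal to both \<open>a\<close>
  and \<open>b\<close> form the kernel of the additive map \<open>t \<mapsto> (\<langle>a,t\<rangle>, \<langle>b,t\<rangle>)\<close>, whose image is computed over
  \<open>K\<close> and over \<open>J\<close>. If \<open>a\<close> and \<open>b\<close> are independent modulo \<open>J\<close>, some \<open>2 \<times> 2\<close> minor is a unit and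
  Cramer's rule makes the map onto \<open>K \<times> K\<close>, resp. \<open>J \<times> J\<close>. If \<open>a = c b + p g\<close> with \<open>p\<close> a generator of \<open>J\<close>,
  but \<open>a\<close> is not a multiple of \<open>b\<close>, then \<open>b\<close> and \<open>g\<close> are independent modulo \<open>J\<close>, and the image over \<open>K\<close>
  has \<open>q\<^sup>3\<close> elements, while over \<open>J\<close> the second condition is implied by the first. The classes of the
  design are the fibres of reduction modulo \<open>J\<close>; inclusion--exclusion gives the parameters.
\<close>

section \<open>The symplectic form over a commutative ring\<close>

text \<open>Lagrange's theorem for the kernel combined with the first isomorphism theorem. The
  codomain is cut down to the image because \<open>FactGroup_iso\<close> asks for a surjective
  homomorphism.\<close>

lemma (in group_hom) card_kernel_mult_card_image:
  "card (kernel G H h) * card (h ` carrier G) = card (carrier G)"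
proof -
  interpret im: group_hom G "H\<lparr>carrier := h ` carrier G\<rparr>" h
    unfolding group_hom_def group_hom_axioms_def
    using G.group_axioms H.subgroup_imp_group[OF img_is_subgroup] homh by (auto simp: hom_def)
  have ker: "kernel G (H\<lparr>carrier := h ` carrier G\<rparr>) h = kernel G H h"
    by (simp add: kernel_def)
  have "G Mod kernel G H h \<cong> H\<lparr>carrier := h ` carrier G\<rparr>"
    using im.FactGroup_iso ker by simp
  then have "card (rcosets kernel G H h) = card (h ` carrier G)"
    by (auto simp: is_iso_def iso_def FactGroup_def dest: bij_betw_same_card)
  then show ?thesis
    using G.lagrange[OF subgroup_kernel] by (simp add: order_def mult.commute)
qed

context cring
begin

text \<open>The entry set is a parameter because orthogonal tuples are counted twice, over the whole
  ring and over \<open>J\<close>.\<close>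

abbreviation tuples :: "nat \<Rightarrow> 'a set \<Rightarrow> (nat \<Rightarrow> 'a) set" where
  "tuples e I \<equiv> {1..2 * e} \<rightarrow>\<^sub>E I"

lemma symp_form_in_carrier:
  assumes "a \<in> tuples e (carrier R)" "b \<in> tuples e (carrier R)"
  shows "symp_form e R a b \<in> carrier R"
  unfolding symp_form_def
  by (intro finsum_closed) (auto intro!: minus_closed m_closed PiE_mem[OF assms(1)] PiE_mem[OF assms(2)])

text \<open>The sum is restricted to the index set so that it agrees with the operation of the
  \<open>product_group\<close> in which tuples are counted below.\<close>

lemma symp_form_add_right:
  assumes a: "a \<in> tuples e (carrier R)" and b: "b \<in> tuples e (carrier R)"
    and c: "c \<in> tuples e (carrier R)"
  shows "symp_form e R a (\<lambda>i\<in>{1..2 * e}. b i \<oplus> c i) = symp_form e R a b \<oplus> symp_form e R a c"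
proof -
  note cl = PiE_mem[OF a] PiE_mem[OF b] PiE_mem[OF c]
  have "symp_form e R a (\<lambda>i\<in>{1..2 * e}. b i \<oplus> c i) =
      (\<Oplus>i \<in> {1..e}. (a i \<otimes> b (e + i) \<ominus> a (e + i) \<otimes> b i) \<oplus>
                    (a i \<otimes> c (e + i) \<ominus> a (e + i) \<otimes> c i))"
    unfolding symp_form_def
  proof (rule finsum_cong')
    fix i assume "i \<in> {1..e}"
    then have i: "i \<in> {1..2 * e}" "e + i \<in> {1..2 * e}" by auto
    show "a i \<otimes> (\<lambda>i\<in>{1..2 * e}. b i \<oplus> c i) (e + i) \<ominus> a (e + i) \<otimes> (\<lambda>i\<in>{1..2 * e}. b i \<oplus> c i) i =
        (a i \<otimes> b (e + i) \<ominus> a (e + i) \<otimes> b i) \<oplus> (a i \<otimes> c (e + i) \<ominus> a (e + i) \<otimes> c i)"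
      unfolding restrict_apply'[OF i(1)] restrict_apply'[OF i(2)]
      using cl(1)[OF i(1)] cl(1)[OF i(2)] cl(2)[OF i(1)] cl(2)[OF i(2)] cl(3)[OF i(1)] cl(3)[OF i(2)]
      by algebra
  qed (use cl in auto)
  also have "\<dots> = symp_form e R a b \<oplus> symp_form e R a c"
    unfolding symp_form_def by (rule finsum_addf) (use cl in auto)
  finally show ?thesis .
qed

lemma symp_form_swap:
  assumes a: "a \<in> tuples e (carrier R)" and b: "b \<in> tuples e (carrier R)"
  shows "symp_form e R b a = \<ominus> symp_form e R a b"
proof -
  note cl = PiE_mem[OF a] PiE_mem[OF b]
  have "symp_form e R a b \<oplus> symp_form e R b a =
     (\<Oplus>i \<in> {1..e}. (a i \<otimes> b (e + i) \<ominus> a (e + i) \<otimes> b i) \<oplus>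
                    (b i \<otimes> a (e + i) \<ominus> b (e + i) \<otimes> a i))"
    unfolding symp_form_def by (rule finsum_addf[symmetric]) (use cl in auto)
  also have "\<dots> = (\<Oplus>i \<in> {1..e}. \<zero>)"
  proof (rule finsum_cong')
    fix i assume "i \<in> {1..e}"
    then have i: "i \<in> {1..2 * e}" "e + i \<in> {1..2 * e}" by auto
    show "(a i \<otimes> b (e + i) \<ominus> a (e + i) \<otimes> b i) \<oplus> (b i \<otimes> a (e + i) \<ominus> b (e + i) \<otimes> a i) = \<zero>"
      using cl(1)[OF i(1)] cl(1)[OF i(2)] cl(2)[OF i(1)] cl(2)[OF i(2)] by algebra
  qed auto
  finally show ?thesis
    using symp_form_in_carrier[OF a b] symp_form_in_carrier[OF b a]
    by (auto simp: a_comm intro: minus_equality[symmetric])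
qed

lemma symp_form_self:
  assumes a: "a \<in> tuples e (carrier R)"
  shows "symp_form e R a a = \<zero>"
proof -
  have "symp_form e R a a = (\<Oplus>i \<in> {1..e}. \<zero>)"
    unfolding symp_form_def
  proof (rule finsum_cong')
    fix i assume "i \<in> {1..e}"
    then have "a i \<in> carrier R" "a (e + i) \<in> carrier R" by (auto intro: PiE_mem[OF a])
    then show "a i \<otimes> a (e + i) \<ominus> a (e + i) \<otimes> a i = \<zero>" by algebra
  qed auto
  then show ?thesis by simp
qed

lemma symp_form_in_ideal:
  assumes I: "ideal I R" and a: "a \<in> tuples e (carrier R)" and b: "b \<in> tuples e I"
  shows "symp_form e R a b \<in> I"
proof -
  interpret I: ideal I R by fact
  have "(\<Oplus>i \<in> A. a i \<otimes> b (e + i) \<ominus> a (e + i) \<otimes> b i) \<in> I" if "finite A" "A \<subseteq> {1..e}" for A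
    using that
  proof (induction rule: finite_induct)
    case (insert i A)
    have t: "a i \<otimes> b (e + i) \<ominus> a (e + i) \<otimes> b i \<in> I" if "i \<in> {1..e}" for i
      using that unfolding a_minus_def
      by (intro I.a_closed I.a_inv_closed I.I_l_closed) (auto intro: PiE_mem[OF a] PiE_mem[OF b])
    then show ?case using insert I.Icarr
      by (subst finsum_insert) auto
  qed simp
  then show ?thesis by (simp add: symp_form_def)
qed

text \<open>Nondegeneracy, valid over every ideal: the witness is \<open>c\<close>, up to sign,
  times the basis vector that the form pairs with index \<open>i\<close>.\<close>

lemma exists_tuple_picking_entry:
  assumes I: "ideal I R" and c: "c \<in> I" and i: "i \<in> {1..2 * e}"
  shows "\<exists>t \<in> tuples e I. \<forall>a \<in> tuples e (carrier R). symp_form e R a t = a i \<otimes> c"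
proof -
  interpret I: ideal I R by fact
  have cc: "c \<in> carrier R" using c by (rule I.Icarr)
  show ?thesis
  proof (cases "i \<le> e")
    case True
    define t where "t = (\<lambda>k\<in>{1..2 * e}. if k = e + i then c else \<zero>)"
    have "symp_form e R a t = a i \<otimes> c" if a: "a \<in> tuples e (carrier R)" for a
    proof -
      have "symp_form e R a t = (\<Oplus>k \<in> {1..e}. if i = k then a k \<otimes> c else \<zero>)"
        unfolding symp_form_def
        by (rule finsum_cong') (use i True cc PiE_mem[OF a] in \<open>auto simp: t_def a_minus_def\<close>)
      also have "\<dots> = a i \<otimes> c"
        by (rule add.finprod_singleton) (use i True cc PiE_mem[OF a] in auto)
      finally show ?thesis .
    qed
    moreover have "t \<in> tuples e I" using c by (auto simp: t_def)
    ultimately show ?thesis by blast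
  next
    case False
    \<comment> \<open>For an index in the second half, the product with the partner coordinate
      enters the form with a minus sign; hence \<open>\<ominus> c\<close>.\<close>
    define t where "t = (\<lambda>k\<in>{1..2 * e}. if k = i - e then \<ominus> c else \<zero>)"
    have "symp_form e R a t = a i \<otimes> c" if a: "a \<in> tuples e (carrier R)" for a
    proof -
      have "symp_form e R a t = (\<Oplus>k \<in> {1..e}. if i - e = k then a (e + k) \<otimes> c else \<zero>)"
        unfolding symp_form_def
        by (rule finsum_cong')
          (use i False cc PiE_mem[OF a] in \<open>auto simp: t_def a_minus_def r_minus\<close>)
      also have "\<dots> = a (e + (i - e)) \<otimes> c"
        by (rule add.finprod_singleton) (use i False cc PiE_mem[OF a] in auto)
      finally show ?thesis using False by simp
    qed
    moreover have "t \<in> tuples e I" using c by (auto simp: t_def)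
    ultimately show ?thesis by blast
  qed
qed

text \<open>Cramer's rule. Two tuples picking out entries \<open>i\<close> and \<open>j\<close> are
  superposed; their coefficients solve the 2 by 2 system with the minor as determinant, and lie in
  \<open>I\<close> because \<open>x\<close> and \<open>y\<close> do.\<close>

lemma symp_form_pair_surj:
  assumes I: "ideal I R"
    and a: "a \<in> tuples e (carrier R)" and b: "b \<in> tuples e (carrier R)"
    and ij: "i \<in> {1..2 * e}" "j \<in> {1..2 * e}"
    and minor: "a i \<otimes> b j \<ominus> a j \<otimes> b i \<in> Units R"
    and x: "x \<in> I" and y: "y \<in> I"
  shows "\<exists>t \<in> tuples e I. symp_form e R a t = x \<and> symp_form e R b t = y"
proof -
  interpret I: ideal I R by fact
  define d where "d = inv (a i \<otimes> b j \<ominus> a j \<otimes> b i)"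
  have cl: "a i \<in> carrier R" "a j \<in> carrier R" "b i \<in> carrier R" "b j \<in> carrier R"
      "x \<in> carrier R" "y \<in> carrier R" "d \<in> carrier R"
    using PiE_mem[OF a] PiE_mem[OF b] ij x y I.Icarr minor by (auto simp: d_def)
  have d: "(a i \<otimes> b j \<ominus> a j \<otimes> b i) \<otimes> d = \<one>"
    using minor by (simp add: d_def)
  have c: "d \<otimes> (b j \<otimes> x \<ominus> a j \<otimes> y) \<in> I" "d \<otimes> (a i \<otimes> y \<ominus> b i \<otimes> x) \<in> I"
    using cl x y unfolding a_minus_def
    by (auto intro!: I.I_l_closed I.a_closed I.a_inv_closed)
  obtain s where s: "s \<in> tuples e I"
    "\<And>g. g \<in> tuples e (carrier R) \<Longrightarrow> symp_form e R g s = g i \<otimes> (d \<otimes> (b j \<otimes> x \<ominus> a j \<otimes> y))"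
    using exists_tuple_picking_entry[OF I c(1) ij(1)] by blast
  obtain t where t: "t \<in> tuples e I"
    "\<And>g. g \<in> tuples e (carrier R) \<Longrightarrow> symp_form e R g t = g j \<otimes> (d \<otimes> (a i \<otimes> y \<ominus> b i \<otimes> x))"
    using exists_tuple_picking_entry[OF I c(2) ij(2)] by blast
  let ?t = "\<lambda>i\<in>{1..2 * e}. s i \<oplus> t i"
  have st: "s \<in> tuples e (carrier R)" "t \<in> tuples e (carrier R)"
    using s(1) t(1) I.a_subset by (auto simp: PiE_iff)
  have "?t \<in> tuples e I" using PiE_mem[OF s(1)] PiE_mem[OF t(1)] by (auto intro: I.a_closed)
  moreover have "symp_form e R a ?t = x"
  proof -
    have "symp_form e R a ?t = a i \<otimes> (d \<otimes> (b j \<otimes> x \<ominus> a j \<otimes> y)) \<oplus> a j \<otimes> (d \<otimes> (a i \<otimes> y \<ominus> b i \<otimes> x))"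
      by (simp only: symp_form_add_right[OF a st] s(2)[OF a] t(2)[OF a])
    also have "\<dots> = ((a i \<otimes> b j \<ominus> a j \<otimes> b i) \<otimes> d) \<otimes> x"
      using cl by algebra
    finally show ?thesis using cl by (simp add: d)
  qed
  moreover have "symp_form e R b ?t = y"
  proof -
    have "symp_form e R b ?t = b i \<otimes> (d \<otimes> (b j \<otimes> x \<ominus> a j \<otimes> y)) \<oplus> b j \<otimes> (d \<otimes> (a i \<otimes> y \<ominus> b i \<otimes> x))"
      by (simp only: symp_form_add_right[OF b st] s(2)[OF b] t(2)[OF b])
    also have "\<dots> = ((a i \<otimes> b j \<ominus> a j \<otimes> b i) \<otimes> d) \<otimes> y"
      using cl by algebra
    finally show ?thesis using cl by (simp add: d)
  qed
  ultimately show ?thesis by blast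
qed

text \<open>Both forms together are a homomorphism of additive groups on the tuples over
  \<open>I\<close>, and the common zeros are its kernel. Counting them thus comes down to finding
  the size of the image.\<close>

lemma card_symp_form_common_zeros:
  assumes I: "ideal I R"
    and a: "a \<in> tuples e (carrier R)" and b: "b \<in> tuples e (carrier R)"
  shows "card {t \<in> tuples e I. symp_form e R a t = \<zero> \<and> symp_form e R b t = \<zero>} *
    card ((\<lambda>t. (symp_form e R a t, symp_form e R b t)) ` tuples e I) = card I ^ (2 * e)"
proof -
  interpret I: ideal I R by fact
  let ?G = "product_group {1..2 * e} (\<lambda>_. (add_monoid R)\<lparr>carrier := I\<rparr>)"
  let ?H = "add_monoid R \<times>\<times> add_monoid R"
  let ?h = "\<lambda>t. (symp_form e R a t, symp_form e R b t)"
  have sub: "tuples e I \<subseteq> tuples e (carrier R)"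
    using I.a_subset by (intro PiE_mono)
  have "?h \<in> hom ?G ?H"
    using sub by (auto intro!: homI simp: symp_form_in_carrier[OF a] symp_form_in_carrier[OF b]
        symp_form_add_right[OF a, simplified] symp_form_add_right[OF b, simplified] subset_iff)
  moreover have "group ?G"
    by (intro product_group add.subgroup_imp_group I.a_subgroup)
  moreover have "group ?H"
    by (intro DirProd_group add.group_axioms)
  ultimately interpret h: group_hom ?G ?H ?h
    unfolding group_hom_def group_hom_axioms_def by blast
  have "kernel ?G ?H ?h = {t \<in> tuples e I. symp_form e R a t = \<zero> \<and> symp_form e R b t = \<zero>}"
    by (auto simp: kernel_def)
  with h.card_kernel_mult_card_image show ?thesis
    by (simp add: card_PiE)
qed

lemma unit_tuples_unit_entry:
  assumes "a \<in> unit_tuples e R" obtains i where "i \<in> {1..2 * e}" "a i \<in> Units R"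
  using assms by (auto simp: unit_tuples_def)

lemma unit_tuples_tuples: "a \<in> unit_tuples e R \<Longrightarrow> a \<in> tuples e (carrier R)"
  by (simp add: unit_tuples_def)

text \<open>Needed to evaluate the form at a tuple written as \<open>c\<close> times
  \<open>b\<close> plus \<open>p\<close> times \<open>g\<close>, the shape of a tuple congruent to a
  multiple of \<open>b\<close>.\<close>

lemma symp_form_linear_left:
  assumes x: "x \<in> tuples e (carrier R)" and y: "y \<in> tuples e (carrier R)"
    and t: "t \<in> tuples e (carrier R)"
    and cd: "c \<in> carrier R" "d \<in> carrier R"
    and eq: "\<And>i. i \<in> {1..2 * e} \<Longrightarrow> a i = c \<otimes> x i \<oplus> d \<otimes> y i"
  shows "symp_form e R a t = c \<otimes> symp_form e R x t \<oplus> d \<otimes> symp_form e R y t"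
proof -
  note cl = PiE_mem[OF x] PiE_mem[OF y] PiE_mem[OF t]
  have "symp_form e R a t =
      (\<Oplus>i \<in> {1..e}. c \<otimes> (x i \<otimes> t (e + i) \<ominus> x (e + i) \<otimes> t i) \<oplus>
                    d \<otimes> (y i \<otimes> t (e + i) \<ominus> y (e + i) \<otimes> t i))"
    unfolding symp_form_def
  proof (rule finsum_cong')
    fix i assume "i \<in> {1..e}"
    then have i: "i \<in> {1..2 * e}" "e + i \<in> {1..2 * e}" by auto
    show "a i \<otimes> t (e + i) \<ominus> a (e + i) \<otimes> t i =
        c \<otimes> (x i \<otimes> t (e + i) \<ominus> x (e + i) \<otimes> t i) \<oplus> d \<otimes> (y i \<otimes> t (e + i) \<ominus> y (e + i) \<otimes> t i)"
      unfolding eq[OF i(1)] eq[OF i(2)]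
      using cd cl(1)[OF i(1)] cl(1)[OF i(2)] cl(2)[OF i(1)] cl(2)[OF i(2)] cl(3)[OF i(1)] cl(3)[OF i(2)]
      by algebra
  qed (use cd cl in auto)
  also have "\<dots> = (\<Oplus>i \<in> {1..e}. c \<otimes> (x i \<otimes> t (e + i) \<ominus> x (e + i) \<otimes> t i)) \<oplus>
      (\<Oplus>i \<in> {1..e}. d \<otimes> (y i \<otimes> t (e + i) \<ominus> y (e + i) \<otimes> t i))"
    by (rule finsum_addf) (use cd cl in auto)
  also have "\<dots> = c \<otimes> symp_form e R x t \<oplus> d \<otimes> symp_form e R y t"
    unfolding symp_form_def
    by (subst (1 2) finsum_rdistr) (use cd cl in auto)
  finally show ?thesis .
qed

text \<open>A unit entry \<open>a i\<close> makes the form onto \<open>I\<close>: the tuple picking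
  out entry \<open>i\<close> with value \<open>inv (a i) \<otimes> x\<close> is sent to
  \<open>x\<close>.\<close>

lemma card_symp_form_zeros:
  assumes I: "ideal I R" and a: "a \<in> unit_tuples e R"
  shows "card {t \<in> tuples e I. symp_form e R a t = \<zero>} * card I = card I ^ (2 * e)"
proof -
  interpret I: ideal I R by fact
  note at = unit_tuples_tuples[OF a]
  obtain i where i: "i \<in> {1..2 * e}" "a i \<in> Units R" using a by (rule unit_tuples_unit_entry)
  have "x \<in> symp_form e R a ` tuples e I" if x: "x \<in> I" for x
  proof -
    have ix: "inv (a i) \<otimes> x \<in> I" using i x by (intro I.I_l_closed) auto
    obtain t where "t \<in> tuples e I" "symp_form e R a t = a i \<otimes> (inv (a i) \<otimes> x)"
      using exists_tuple_picking_entry[OF I ix i(1)] at by blast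
    moreover have "a i \<otimes> (inv (a i) \<otimes> x) = x"
      using i x I.Icarr Units_closed by (simp add: m_assoc[symmetric])
    ultimately show ?thesis by force
  qed
  then have im: "symp_form e R a ` tuples e I = I"
    using symp_form_in_ideal[OF I at] by auto
  \<comment> \<open>The count for two forms is reused with both equal; its image is then the
    diagonal of \<open>I \<times> I\<close>.\<close>
  have "(\<lambda>t. (symp_form e R a t, symp_form e R a t)) ` tuples e I = (\<lambda>x. (x, x)) ` I"
    by (subst im[symmetric]) (simp only: image_image)
  then have "card ((\<lambda>t. (symp_form e R a t, symp_form e R a t)) ` tuples e I) = card I"
    by (simp add: card_image inj_on_def)
  then show ?thesis
    using card_symp_form_common_zeros[OF I at at] by simp
qed

lemma card_symp_form_zeros_unit_minor:
  assumes I: "ideal I R"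
    and a: "a \<in> tuples e (carrier R)" and b: "b \<in> tuples e (carrier R)"
    and ij: "i \<in> {1..2 * e}" "j \<in> {1..2 * e}"
    and minor: "a i \<otimes> b j \<ominus> a j \<otimes> b i \<in> Units R"
  shows "card {t \<in> tuples e I. symp_form e R a t = \<zero> \<and> symp_form e R b t = \<zero>} * (card I)\<^sup>2
    = card I ^ (2 * e)"
proof -
  have "(\<lambda>t. (symp_form e R a t, symp_form e R b t)) ` tuples e I = I \<times> I"
  proof (intro equalityI subsetI)
    fix z assume "z \<in> I \<times> I"
    then obtain x y where z: "z = (x, y)" "x \<in> I" "y \<in> I" by blast
    then show "z \<in> (\<lambda>t. (symp_form e R a t, symp_form e R b t)) ` tuples e I"
      using symp_form_pair_surj[OF I a b ij minor z(2,3)] by force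
  qed (use symp_form_in_ideal[OF I a] symp_form_in_ideal[OF I b] in auto)
  then show ?thesis
    using card_symp_form_common_zeros[OF I a b] by (simp add: card_cartesian_product power2_eq_square)
qed

section \<open>Vertices as orbits of the unit group\<close>

lemma card_tuple_class:
  assumes a: "a \<in> unit_tuples e R"
  shows "card (tuple_class e R a) = card (Units R)"
proof -
  obtain i where i: "i \<in> {1..2 * e}" "a i \<in> Units R" using a by (rule unit_tuples_unit_entry)
  let ?f = "\<lambda>c. \<lambda>k\<in>{1..2 * e}. c \<otimes> a k"
  \<comment> \<open>The action is free because the unit entry \<open>a i\<close> can be
    cancelled.\<close>
  have "inj_on ?f (Units R)"
  proof (rule inj_onI)
    fix c d assume cd: "c \<in> Units R" "d \<in> Units R" "?f c = ?f d"
    have "c \<otimes> a i = d \<otimes> a i" using fun_cong[OF cd(3), of i] i(1) by simp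
    then have "a i \<otimes> c = a i \<otimes> d" using cd i Units_closed by (simp add: m_comm)
    then show "c = d" using cd i by (simp add: Units_l_cancel Units_closed)
  qed
  moreover have "tuple_class e R a = ?f ` Units R"
  proof (intro equalityI subsetI)
    fix b assume "b \<in> tuple_class e R a"
    then have ab: "(b, a) \<in> tuple_rel e R"
      using equiv_tuple_rel[of e] by (auto simp: equiv_def sym_def)
    then obtain c where c: "c \<in> Units R" "\<And>k. k \<in> {1..2 * e} \<Longrightarrow> b k = c \<otimes> a k"
      by (auto simp: tuple_rel_def)
    have "b \<in> extensional {1..2 * e}" using ab by (auto simp: tuple_rel_def unit_tuples_def PiE_def)
    then have "b = ?f c" using c(2) by (intro extensionalityI[of _ "{1..2 * e}"]) auto
    then show "b \<in> ?f ` Units R" using c(1) by blast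
  next
    fix b assume "b \<in> ?f ` Units R"
    then obtain c where c: "c \<in> Units R" "b = ?f c" by blast
    have "b i \<in> Units R" using c i by simp
    then have "b \<in> unit_tuples e R"
      using c i(1) unit_tuples_carrier[OF a] Units_closed unfolding unit_tuples_def by auto
    then have "(b, a) \<in> tuple_rel e R"
      using a c by (auto simp: tuple_rel_def)
    then show "b \<in> tuple_class e R a"
      using equiv_tuple_rel[of e] by (auto simp: equiv_def sym_def)
  qed
  ultimately show ?thesis by (simp add: card_image)
qed

lemma pverts_symp_graph: "pverts (symp_graph e R) = tuple_class e R ` unit_tuples e R"
  by (auto simp: symp_graph_def quotient_def)

text \<open>Adjacency can be tested on any representatives, which moves the count from vertices to
  tuples. The case \<open>a = b\<close> later yields the degree.\<close>

lemma common_neighbours_eq: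
  assumes a: "a \<in> unit_tuples e R" and b: "b \<in> unit_tuples e R"
  shows "common_neighbours (symp_graph e R) (tuple_class e R a) (tuple_class e R b) =
    tuple_class e R ` {t \<in> unit_tuples e R. symp_form e R a t \<noteq> \<zero> \<and> symp_form e R b t \<noteq> \<zero>}"
  using symp_graph_adj_iff[OF a] symp_graph_adj_iff[OF b] symp_form_closed[OF a] symp_form_closed[OF b]
  unfolding common_neighbours_def neighbours_def pverts_symp_graph by auto

end

section \<open>Rings with exactly three ideals\<close>

text \<open>The cardinality condition is what makes the three listed ideals distinct.\<close>

locale three_ideal_ring = cring R for R (structure) +
  fixes J :: "'a set"
  assumes finite_carrier: "finite (carrier R)"
    and ideals: "{I. ideal I R} = {{\<zero>}, J, carrier R}"
    and card_ideals: "card {I. ideal I R} = 3"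
begin

sublocale J: ideal J R
  using ideals by blast

lemma J_neq: "J \<noteq> {\<zero>}" "J \<noteq> carrier R"
proof -
  have c: "card {{\<zero>}, J, carrier R} = 3"
    using card_ideals ideals by simp
  show "J \<noteq> {\<zero>}" "J \<noteq> carrier R"
    using c by (auto simp: card_insert_if split: if_splits)
qed

lemma ideal_cases: "ideal I R \<Longrightarrow> I = {\<zero>} \<or> I = J \<or> I = carrier R"
  using ideals by blast

lemma finite_J: "finite J"
  using J.a_subset finite_carrier by (rule finite_subset)

lemma one_notin_J: "\<one> \<notin> J"
  using J.one_imp_carrier J_neq(2) by blast

text \<open>An element outside \<open>J\<close> generates an ideal that is neither zero nor
  \<open>J\<close>, hence the whole ring; a unit inside \<open>J\<close> would put
  \<open>\<one>\<close> into \<open>J\<close>.\<close>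

lemma Units_eq: "Units R = carrier R - J"
proof (intro equalityI subsetI)
  fix x assume x: "x \<in> Units R"
  show "x \<in> carrier R - J"
    using x J.I_l_closed[of x "inv x"] one_notin_J by auto
next
  fix x assume x: "x \<in> carrier R - J"
  have "PIdl x = carrier R"
    using ideal_cases[OF cgenideal_ideal, of x] cgenideal_self[of x] x J.zero_closed by fastforce
  then obtain y where "y \<in> carrier R" "\<one> = y \<otimes> x"
    using one_closed unfolding cgenideal_def by blast
  then show "x \<in> Units R"
    using x m_comm[of x y] unfolding Units_def by auto
qed

text \<open>Any nonzero \<open>p\<close> in \<open>J\<close> works: its principal ideal is nonzero
  and inside \<open>J\<close>, so it equals \<open>J\<close>. The annihilator of \<open>p\<close> is
  \<open>J\<close> because \<open>p \<otimes> p\<close> vanishes and everything outside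
  \<open>J\<close> is a unit.\<close>

lemma exists_generator:
  "\<exists>p \<in> J. J = {r \<otimes> p | r. r \<in> carrier R} \<and> (\<forall>x \<in> carrier R. x \<otimes> p = \<zero> \<longleftrightarrow> x \<in> J)"
proof -
  obtain p where p: "p \<in> J" "p \<noteq> \<zero>"
    using J_neq(1) J.zero_closed by blast
  then have pc: "p \<in> carrier R" by simp
  have "PIdl p \<subseteq> J"
    using cgenideal_minimal[OF J.is_ideal p(1)] .
  then have gen: "PIdl p = J"
    using ideal_cases[OF cgenideal_ideal[OF pc]] cgenideal_self[OF pc] p J.a_subset J_neq(2) by blast
  \<comment> \<open>Nakayama's argument: otherwise \<open>p \<otimes> p\<close> also generates
    \<open>J\<close>, so \<open>p\<close> is a multiple \<open>r \<otimes> (p \<otimes> p)\<close>,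
    and the unit \<open>\<one> \<ominus> r \<otimes> p\<close> would kill \<open>p\<close>.\<close>
  have pp: "p \<otimes> p = \<zero>"
  proof (rule ccontr)
    assume "p \<otimes> p \<noteq> \<zero>"
    moreover have ppc: "p \<otimes> p \<in> carrier R" "p \<otimes> p \<in> J" using p pc J.I_l_closed by auto
    moreover have "PIdl (p \<otimes> p) \<subseteq> J"
      using cgenideal_minimal[OF J.is_ideal ppc(2)] .
    ultimately have "PIdl (p \<otimes> p) = J"
      using ideal_cases[OF cgenideal_ideal[OF ppc(1)]] cgenideal_self[OF ppc(1)] J.a_subset J_neq(2)
      by blast
    then obtain r where r: "r \<in> carrier R" "p = r \<otimes> (p \<otimes> p)"
      using p(1) unfolding cgenideal_def by blast
    have rp: "r \<otimes> p \<in> J" using r p J.I_l_closed by simp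
    have "\<one> \<ominus> r \<otimes> p \<notin> J"
    proof
      assume "\<one> \<ominus> r \<otimes> p \<in> J"
      then have "(\<one> \<ominus> r \<otimes> p) \<oplus> r \<otimes> p \<in> J" using rp by (rule J.a_closed)
      moreover have "(\<one> \<ominus> r \<otimes> p) \<oplus> r \<otimes> p = \<one>" using r pc by algebra
      ultimately show False using one_notin_J by simp
    qed
    then have u: "\<one> \<ominus> r \<otimes> p \<in> Units R" using r pc by (simp add: Units_eq)
    have "(\<one> \<ominus> r \<otimes> p) \<otimes> p = p \<ominus> r \<otimes> (p \<otimes> p)" using r(1) pc by algebra
    also have "\<dots> = \<zero>" using r pc by (simp add: a_minus_def r_neg)
    finally have "(\<one> \<ominus> r \<otimes> p) \<otimes> p = (\<one> \<ominus> r \<otimes> p) \<otimes> \<zero>" using u by (simp add: Units_closed)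
    then show False using u pc p by (simp add: Units_l_cancel)
  qed
  have "x \<otimes> p = \<zero> \<longleftrightarrow> x \<in> J" if x: "x \<in> carrier R" for x
  proof
    assume xp: "x \<otimes> p = \<zero>"
    show "x \<in> J"
    proof (rule ccontr)
      assume "x \<notin> J"
      then have "x \<in> Units R" using x by (simp add: Units_eq)
      then show False using xp p pc x Units_l_cancel[of x p \<zero>] by simp
    qed
  next
    assume "x \<in> J"
    then obtain r where "r \<in> carrier R" "x = r \<otimes> p"
      using gen unfolding cgenideal_def by blast
    then show "x \<otimes> p = \<zero>" using pp pc by (simp add: m_assoc)
  qed
  then show ?thesis using p(1) gen unfolding cgenideal_def by blast
qed

lemma J_mult_J: "x \<in> J \<Longrightarrow> y \<in> J \<Longrightarrow> x \<otimes> y = \<zero>"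
proof -
  assume xy: "x \<in> J" "y \<in> J"
  obtain p where p: "p \<in> J" "J = {r \<otimes> p | r. r \<in> carrier R}" "\<And>x. x \<in> carrier R \<Longrightarrow> x \<otimes> p = \<zero> \<longleftrightarrow> x \<in> J"
    using exists_generator by blast
  obtain r where r: "r \<in> carrier R" "y = r \<otimes> p" using xy(2) p(2) by blast
  have "x \<otimes> y = r \<otimes> (x \<otimes> p)" using r xy p(1) J.Icarr by (simp add: m_lcomm)
  then show ?thesis using p(3)[of x] xy(1) J.Icarr r by simp
qed

text \<open>Multiplication by the generator \<open>p\<close> is an additive endomorphism whose
  kernel and image are both \<open>J\<close>.\<close>

lemma card_carrier: "card (carrier R) = (card J)\<^sup>2"
proof -
  obtain p where p: "p \<in> J" "J = {r \<otimes> p | r. r \<in> carrier R}" "\<And>x. x \<in> carrier R \<Longrightarrow> x \<otimes> p = \<zero> \<longleftrightarrow> x \<in> J"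
    using exists_generator by blast
  have "(\<lambda>r. r \<otimes> p) \<in> hom (add_monoid R) (add_monoid R)"
    using p(1) by (auto intro!: homI simp: l_distr)
  then interpret h: group_hom "add_monoid R" "add_monoid R" "\<lambda>r. r \<otimes> p"
    unfolding group_hom_def group_hom_axioms_def using add.group_axioms by auto
  have "kernel (add_monoid R) (add_monoid R) (\<lambda>r. r \<otimes> p) = J"
    using p(3) J.Icarr by (auto simp: kernel_def)
  moreover have "(\<lambda>r. r \<otimes> p) ` carrier R = J" unfolding p(2) by auto
  ultimately show ?thesis
    using h.card_kernel_mult_card_image by (simp add: power2_eq_square)
qed

lemma card_J_pos: "card J > 0"
  using finite_J J.zero_closed card_gt_0_iff by blast

text \<open>Lagrange's theorem for the cosets of \<open>J\<close>. This identifies \<open>q\<close>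
  with \<open>card J\<close>, the quantity in which all counts are expressed.\<close>

lemma order_Quot: "order (R Quot J) = card J"
proof -
  have "card (a_rcosets J) * card J = card J * card J"
    using a_lagrange[OF finite_carrier J.additive_subgroup_axioms] card_carrier
    by (simp add: order_def power2_eq_square)
  then show ?thesis using card_J_pos by (simp add: order_def FactRing_def)
qed

lemma card_J_ge_2: "card J \<ge> 2"
proof -
  obtain p where "p \<in> J" "p \<noteq> \<zero>" using J_neq(1) J.zero_closed by blast
  then have "card {\<zero>, p} \<le> card J" using finite_J by (intro card_mono) auto
  then show ?thesis using \<open>p \<noteq> \<zero>\<close> by (simp add: card_insert_if split: if_splits)
qed

text \<open>Counts are cast to the reals from here on, so that differences and quotients are not
  truncated.\<close>

lemma real_card_Units: "real (card (Units R)) = real (card J) ^ 2 - real (card J)"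
proof -
  have "card (Units R) = (card J)\<^sup>2 - card J"
    unfolding Units_eq using J.a_subset finite_J by (simp add: card_Diff_subset card_carrier)
  then show ?thesis by (simp add: of_nat_diff power2_eq_square)
qed

section \<open>Tuples modulo the maximal ideal\<close>

lemma add_J_in_Units: "u \<in> Units R \<Longrightarrow> x \<in> J \<Longrightarrow> u \<oplus> x \<in> Units R"
proof -
  assume u: "u \<in> Units R" and x: "x \<in> J"
  have "u \<in> J" if "u \<oplus> x \<in> J"
  proof -
    have "(u \<oplus> x) \<oplus> \<ominus> x \<in> J" using that x J.a_closed J.a_inv_closed by blast
    moreover have "(u \<oplus> x) \<oplus> \<ominus> x = u" using u x J.Icarr[OF x] Units_closed[OF u] by algebra
    ultimately show ?thesis by simp
  qed
  then show ?thesis using u x J.Icarr by (auto simp: Units_eq)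
qed

lemma unit_tuples_eq: "unit_tuples e R = tuples e (carrier R) - tuples e J"
proof (intro equalityI subsetI)
  fix a assume "a \<in> tuples e (carrier R) - tuples e J"
  then show "a \<in> unit_tuples e R"
    unfolding unit_tuples_def Units_eq mem_Collect_eq PiE_iff Diff_iff by blast
qed (auto simp: unit_tuples_def Units_eq PiE_iff)

lemma finite_unit_tuples: "finite (unit_tuples e R)"
  unfolding unit_tuples_def using finite_carrier by (auto intro!: finite_Collect_conjI finite_PiE)

lemma finite_tuples: "ideal I R \<Longrightarrow> finite (tuples e I)"
  using finite_subset[OF additive_subgroup.a_subset[OF ideal.axioms(1)] finite_carrier]
  by (intro finite_PiE) auto

text \<open>Elimination with pivot \<open>a i\<close>: if no minor through column \<open>i\<close>
  is a unit, all of them lie in \<open>J\<close>, and dividing by the pivot shows that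
  \<open>b\<close> is congruent to \<open>inv (a i) \<otimes> b i\<close> times
  \<open>a\<close>.\<close>

lemma unit_minor_or_congruent_multiple:
  assumes a: "a \<in> tuples e (carrier R)" and b: "b \<in> tuples e (carrier R)"
    and i: "i \<in> {1..2 * e}" "a i \<in> Units R"
  shows "(\<exists>j \<in> {1..2 * e}. a i \<otimes> b j \<ominus> a j \<otimes> b i \<in> Units R) \<or>
    (\<exists>d \<in> carrier R. \<forall>k \<in> {1..2 * e}. b k \<ominus> d \<otimes> a k \<in> J)"
proof (subst disj_commute, rule disjCI)
  assume no: "\<not> (\<exists>j \<in> {1..2 * e}. a i \<otimes> b j \<ominus> a j \<otimes> b i \<in> Units R)"
  let ?u = "inv (a i)"
  have u: "?u \<in> carrier R" "?u \<otimes> a i = \<one>" using i by auto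
  have "b k \<ominus> (?u \<otimes> b i) \<otimes> a k \<in> J" if k: "k \<in> {1..2 * e}" for k
  proof -
    have cl: "a i \<in> carrier R" "a k \<in> carrier R" "b i \<in> carrier R" "b k \<in> carrier R"
      using PiE_mem[OF a] PiE_mem[OF b] i(1) k by auto
    then have "a i \<otimes> b k \<ominus> a k \<otimes> b i \<in> J"
      using no k by (auto simp: Units_eq)
    then have "?u \<otimes> (a i \<otimes> b k \<ominus> a k \<otimes> b i) \<in> J"
      using u by (intro J.I_l_closed)
    moreover have "?u \<otimes> (a i \<otimes> b k \<ominus> a k \<otimes> b i) = (?u \<otimes> a i) \<otimes> b k \<ominus> (?u \<otimes> b i) \<otimes> a k"
      using cl u(1) by algebra
    ultimately show ?thesis using u(2) cl by simp
  qed
  then show "\<exists>d \<in> carrier R. \<forall>k \<in> {1..2 * e}. b k \<ominus> d \<otimes> a k \<in> J"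
    using u PiE_mem[OF b i(1)] by blast
qed

text \<open>Two tuples are related when they reduce to the same point of the projective space over
  the residue field; this avoids building the quotient ring.\<close>

definition congruent_tuples :: "nat \<Rightarrow> (nat \<Rightarrow> 'a) rel" where
  "congruent_tuples e = {(a, b) \<in> unit_tuples e R \<times> unit_tuples e R.
     \<exists>c \<in> Units R. \<forall>i \<in> {1..2 * e}. a i \<ominus> c \<otimes> b i \<in> J}"

lemma equiv_congruent_tuples: "equiv (unit_tuples e R) (congruent_tuples e)"
proof (rule equivI)
  show "congruent_tuples e \<subseteq> unit_tuples e R \<times> unit_tuples e R"
    by (auto simp: congruent_tuples_def)
  show "refl_on (unit_tuples e R) (congruent_tuples e)"
    using J.zero_closed unit_tuples_carrier
    by (auto simp: congruent_tuples_def a_minus_def r_neg intro!: refl_onI bexI[of _ \<one>])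
  show "sym (congruent_tuples e)"
  proof (rule symI)
    fix a b assume "(a, b) \<in> congruent_tuples e"
    then obtain c where ab: "a \<in> unit_tuples e R" "b \<in> unit_tuples e R" and c: "c \<in> Units R"
      and eq: "\<And>i. i \<in> {1..2 * e} \<Longrightarrow> a i \<ominus> c \<otimes> b i \<in> J"
      by (auto simp: congruent_tuples_def)
    have "b i \<ominus> inv c \<otimes> a i \<in> J" if i: "i \<in> {1..2 * e}" for i
    proof -
      have "(\<ominus> (inv c)) \<otimes> (a i \<ominus> c \<otimes> b i) \<in> J"
        using eq[OF i] c by (intro J.I_l_closed) auto
      moreover have "(\<ominus> (inv c)) \<otimes> (a i \<ominus> c \<otimes> b i) = (inv c \<otimes> c) \<otimes> b i \<ominus> inv c \<otimes> a i"
        using unit_tuples_carrier[OF ab(1) i] unit_tuples_carrier[OF ab(2) i]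
          Units_closed[OF c] Units_inv_closed[OF c] by algebra
      ultimately show ?thesis using c unit_tuples_carrier[OF ab(2) i] by simp
    qed
    then show "(b, a) \<in> congruent_tuples e"
      using ab c by (auto simp: congruent_tuples_def intro!: bexI[of _ "inv c"])
  qed
  show "trans (congruent_tuples e)"
  proof (rule transI)
    fix a b d assume "(a, b) \<in> congruent_tuples e" "(b, d) \<in> congruent_tuples e"
    then obtain c c' where abd: "a \<in> unit_tuples e R" "b \<in> unit_tuples e R" "d \<in> unit_tuples e R"
      and c: "c \<in> Units R" "c' \<in> Units R"
      and eq: "\<And>i. i \<in> {1..2 * e} \<Longrightarrow> a i \<ominus> c \<otimes> b i \<in> J"
        "\<And>i. i \<in> {1..2 * e} \<Longrightarrow> b i \<ominus> c' \<otimes> d i \<in> J"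
      by (auto simp: congruent_tuples_def)
    have "a i \<ominus> (c \<otimes> c') \<otimes> d i \<in> J" if i: "i \<in> {1..2 * e}" for i
    proof -
      have "(a i \<ominus> c \<otimes> b i) \<oplus> c \<otimes> (b i \<ominus> c' \<otimes> d i) \<in> J"
        using eq(1)[OF i] J.I_l_closed[OF eq(2)[OF i] Units_closed[OF c(1)]] by (rule J.a_closed)
      moreover have "(a i \<ominus> c \<otimes> b i) \<oplus> c \<otimes> (b i \<ominus> c' \<otimes> d i) = a i \<ominus> (c \<otimes> c') \<otimes> d i"
        using unit_tuples_carrier[OF abd(1) i] unit_tuples_carrier[OF abd(2) i]
          unit_tuples_carrier[OF abd(3) i] Units_closed[OF c(1)] Units_closed[OF c(2)] by algebra
      ultimately show ?thesis by simp
    qed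
    then show "(a, d) \<in> congruent_tuples e"
      using abd c by (auto simp: congruent_tuples_def intro!: bexI[of _ "c \<otimes> c'"])
  qed
qed

lemma tuple_rel_subset_congruent_tuples: "tuple_rel e R \<subseteq> congruent_tuples e"
proof (rule subrelI)
  fix a b assume "(a, b) \<in> tuple_rel e R"
  then obtain c where ab: "a \<in> unit_tuples e R" "b \<in> unit_tuples e R" and c: "c \<in> Units R"
    and eq: "\<And>i. i \<in> {1..2 * e} \<Longrightarrow> a i = c \<otimes> b i"
    by (auto simp: tuple_rel_def)
  have "a i \<ominus> c \<otimes> b i \<in> J" if i: "i \<in> {1..2 * e}" for i
    using eq[OF i] unit_tuples_carrier[OF ab(1) i] J.zero_closed by (simp add: a_minus_def r_neg)
  then show "(a, b) \<in> congruent_tuples e"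
    unfolding congruent_tuples_def using ab c by blast
qed

text \<open>A set closed under unit multiples is a disjoint union of orbits, all of size
  \<open>card (Units R)\<close>. Every later vertex count goes through this division.\<close>

lemma card_tuple_classes:
  assumes W: "W \<subseteq> unit_tuples e R"
    and closed: "\<And>a b. a \<in> W \<Longrightarrow> (a, b) \<in> tuple_rel e R \<Longrightarrow> b \<in> W"
  shows "real (card (tuple_class e R ` W)) = real (card W) / (real (card J) ^ 2 - real (card J))"
proof -
  have fin: "finite W" using finite_subset[OF W finite_unit_tuples] .
  have un: "\<Union> (tuple_class e R ` W) = W"
    using closed equiv_class_self[OF equiv_tuple_rel] W by blast
  have "card (Units R) * card (tuple_class e R ` W) = card (\<Union> (tuple_class e R ` W))"
  proof (rule card_partition)
    show "finite (tuple_class e R ` W)" using fin by simp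
    show "finite (\<Union> (tuple_class e R ` W))" using fin un by simp
    show "card c = card (Units R)" if "c \<in> tuple_class e R ` W" for c
      using that card_tuple_class W by blast
    show "c \<inter> d = {}" if "c \<in> tuple_class e R ` W" "d \<in> tuple_class e R ` W" "c \<noteq> d" for c d
    proof -
      have "c \<in> unit_tuples e R // tuple_rel e R" "d \<in> unit_tuples e R // tuple_rel e R"
        using that(1,2) W by (auto intro: quotientI)
      then show ?thesis using quotient_disj[OF equiv_tuple_rel] that(3) by blast
    qed
  qed
  then have "(real (card J) ^ 2 - real (card J)) * real (card (tuple_class e R ` W)) = real (card W)"
    unfolding un real_card_Units[symmetric] by (simp flip: of_nat_mult)
  moreover have "real (card J) ^ 2 - real (card J) \<noteq> 0"
    using card_J_ge_2 by (simp add: power2_eq_square)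
  ultimately show ?thesis by (simp add: field_simps)
qed

section \<open>Counting orthogonal tuples\<close>

text \<open>Unit tuples do not form a group, so they are counted as a difference of two sets to
  which the kernel argument applies.\<close>

lemma card_unit_tuples_Collect:
  "real (card {t \<in> unit_tuples e R. P t}) =
    real (card {t \<in> tuples e (carrier R). P t}) - real (card {t \<in> tuples e J. P t})"
proof -
  have "{t \<in> unit_tuples e R. P t} = {t \<in> tuples e (carrier R). P t} - {t \<in> tuples e J. P t}"
    by (auto simp: unit_tuples_eq)
  moreover have "{t \<in> tuples e J. P t} \<subseteq> {t \<in> tuples e (carrier R). P t}"
    using J.a_subset by (auto simp: PiE_iff)
  moreover have "finite {t \<in> tuples e (carrier R). P t}" using finite_tuples[OF oneideal] by simp
  ultimately show ?thesis
    by (simp add: card_Diff_subset of_nat_diff card_mono finite_subset)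
qed

lemma card_unit_tuples:
  "real (card (unit_tuples e R)) = real (card J) ^ (4 * e) - real (card J) ^ (2 * e)"
  using card_unit_tuples_Collect[of e "\<lambda>_. True"]
  by (simp add: card_PiE card_carrier flip: power_mult)

lemma card_unit_zeros:
  assumes a: "a \<in> unit_tuples e R"
  shows "real (card {t \<in> unit_tuples e R. symp_form e R a t = \<zero>}) =
    real (card J) ^ (4 * e) / real (card J) ^ 2 - real (card J) ^ (2 * e) / real (card J)"
proof -
  have "real (card {t \<in> tuples e (carrier R). symp_form e R a t = \<zero>}) =
      real (card J) ^ (4 * e) / real (card J) ^ 2"
    using arg_cong[OF card_symp_form_zeros[OF oneideal a], of real] card_J_pos
    by (simp add: card_carrier field_simps flip: power_mult)
  moreover have "real (card {t \<in> tuples e J. symp_form e R a t = \<zero>}) =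
      real (card J) ^ (2 * e) / real (card J)"
    using arg_cong[OF card_symp_form_zeros[OF J.is_ideal a], of real] card_J_pos
    by (simp add: field_simps)
  ultimately show ?thesis by (simp add: card_unit_tuples_Collect)
qed

lemma card_unit_common_zeros_not_congruent:
  assumes a: "a \<in> unit_tuples e R" and b: "b \<in> unit_tuples e R"
    and ncong: "(a, b) \<notin> congruent_tuples e"
  shows "real (card {t \<in> unit_tuples e R. symp_form e R a t = \<zero> \<and> symp_form e R b t = \<zero>}) =
    real (card J) ^ (4 * e) / real (card J) ^ 4 - real (card J) ^ (2 * e) / real (card J) ^ 2"
proof -
  note at = unit_tuples_tuples[OF a] and bt = unit_tuples_tuples[OF b]
  obtain i where i: "i \<in> {1..2 * e}" "b i \<in> Units R" using b by (rule unit_tuples_unit_entry)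
  \<comment> \<open>The elimination lemma gives an arbitrary multiplier \<open>d\<close>, while
    \<open>congruent_tuples\<close> asks for a unit. A multiplier in \<open>J\<close> would force
    every entry of \<open>a\<close> into \<open>J\<close>.\<close>
  have "\<not> (\<exists>d \<in> carrier R. \<forall>k \<in> {1..2 * e}. a k \<ominus> d \<otimes> b k \<in> J)"
  proof
    assume "\<exists>d \<in> carrier R. \<forall>k \<in> {1..2 * e}. a k \<ominus> d \<otimes> b k \<in> J"
    then obtain d where d: "d \<in> carrier R" "\<And>k. k \<in> {1..2 * e} \<Longrightarrow> a k \<ominus> d \<otimes> b k \<in> J" by blast
    have "d \<notin> J"
    proof
      assume dJ: "d \<in> J"
      have "a k \<in> J" if k: "k \<in> {1..2 * e}" for k
      proof -
        have "(a k \<ominus> d \<otimes> b k) \<oplus> d \<otimes> b k \<in> J"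
          using d(2)[OF k] J.I_r_closed[OF dJ unit_tuples_carrier[OF b k]] by (rule J.a_closed)
        moreover have "(a k \<ominus> d \<otimes> b k) \<oplus> d \<otimes> b k = a k"
          using d(1) unit_tuples_carrier[OF b k] unit_tuples_carrier[OF a k] by algebra
        ultimately show ?thesis by simp
      qed
      then show False using a by (auto simp: unit_tuples_def Units_eq)
    qed
    then have "d \<in> Units R" using d(1) by (simp add: Units_eq)
    then show False using ncong a b d(2) unfolding congruent_tuples_def by blast
  qed
  then obtain j where j: "j \<in> {1..2 * e}" "b i \<otimes> a j \<ominus> b j \<otimes> a i \<in> Units R"
    using unit_minor_or_congruent_multiple[OF bt at i] by blast
  \<comment> \<open>The pivot lies in \<open>b\<close>, so the counting lemma delivers the two
    conditions in the opposite order.\<close>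
  have swap: "{t \<in> T. symp_form e R a t = \<zero> \<and> symp_form e R b t = \<zero>} =
      {t \<in> T. symp_form e R b t = \<zero> \<and> symp_form e R a t = \<zero>}" for T
    by blast
  have "real (card {t \<in> tuples e (carrier R). symp_form e R a t = \<zero> \<and> symp_form e R b t = \<zero>}) =
      real (card J) ^ (4 * e) / real (card J) ^ 4"
    using arg_cong[OF card_symp_form_zeros_unit_minor[OF oneideal bt at i(1) j], of real] card_J_pos
    unfolding swap by (simp add: card_carrier field_simps flip: power_mult)
  moreover have "real (card {t \<in> tuples e J. symp_form e R a t = \<zero> \<and> symp_form e R b t = \<zero>}) =
      real (card J) ^ (2 * e) / real (card J) ^ 2"
    using arg_cong[OF card_symp_form_zeros_unit_minor[OF J.is_ideal bt at i(1) j], of real] card_J_pos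
    unfolding swap by (simp add: field_simps)
  ultimately show ?thesis by (simp add: card_unit_tuples_Collect)
qed

text \<open>Over the ring, the value at \<open>a\<close> is a unit multiple of the value at
  \<open>b\<close> up to an arbitrary element of \<open>J\<close>. Over \<open>J\<close> that extra
  term vanishes, since \<open>J\<close> squares to zero, so one condition remains.\<close>

lemma card_unit_common_zeros_congruent:
  assumes cong: "(a, b) \<in> congruent_tuples e" and nrel: "(a, b) \<notin> tuple_rel e R"
  shows "real (card {t \<in> unit_tuples e R. symp_form e R a t = \<zero> \<and> symp_form e R b t = \<zero>}) =
    real (card J) ^ (4 * e) / real (card J) ^ 3 - real (card J) ^ (2 * e) / real (card J)"
proof -
  obtain c where a: "a \<in> unit_tuples e R" and b: "b \<in> unit_tuples e R" and c: "c \<in> Units R"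
    and ab: "\<And>k. k \<in> {1..2 * e} \<Longrightarrow> a k \<ominus> c \<otimes> b k \<in> J"
    using cong by (auto simp: congruent_tuples_def)
  note at = unit_tuples_tuples[OF a] and bt = unit_tuples_tuples[OF b] and cc = Units_closed[OF c]
  obtain i where i: "i \<in> {1..2 * e}" "b i \<in> Units R" using b by (rule unit_tuples_unit_entry)
  obtain p where p: "p \<in> J" "J = {r \<otimes> p | r. r \<in> carrier R}"
    using exists_generator by blast
  note pc = J.Icarr[OF p(1)]
  have "\<exists>r \<in> carrier R. a k \<ominus> c \<otimes> b k = r \<otimes> p" if "k \<in> {1..2 * e}" for k
    using ab[OF that] p(2) by blast
  then obtain f where f: "\<And>k. k \<in> {1..2 * e} \<Longrightarrow> f k \<in> carrier R \<and> a k \<ominus> c \<otimes> b k = f k \<otimes> p"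
    by metis
  \<comment> \<open>\<open>g\<close> is a chosen quotient of \<open>a\<close> minus \<open>c\<close>
    times \<open>b\<close> by the generator \<open>p\<close>.\<close>
  define g where "g = restrict f {1..2 * e}"
  have g: "g \<in> tuples e (carrier R)" using f by (auto simp: g_def)
  have a_eq: "a k = c \<otimes> b k \<oplus> p \<otimes> g k" if k: "k \<in> {1..2 * e}" for k
  proof -
    have "a k = c \<otimes> b k \<oplus> (a k \<ominus> c \<otimes> b k)"
      using cc unit_tuples_carrier[OF a k] unit_tuples_carrier[OF b k] by algebra
    then show ?thesis using f[OF k] k pc by (simp add: g_def m_comm)
  qed
  have form: "symp_form e R a t = c \<otimes> symp_form e R b t \<oplus> p \<otimes> symp_form e R g t"
    if "t \<in> tuples e (carrier R)" for t
    by (rule symp_form_linear_left[OF bt g that cc pc a_eq])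
  \<comment> \<open>If \<open>g\<close> were congruent to \<open>d\<close> times \<open>b\<close>,
    the error would be killed by \<open>p\<close>, and \<open>a\<close> would be exactly the unit
    \<open>c \<oplus> d \<otimes> p\<close> times \<open>b\<close>, against
    \<open>nrel\<close>.\<close>
  have "\<not> (\<exists>d \<in> carrier R. \<forall>k \<in> {1..2 * e}. g k \<ominus> d \<otimes> b k \<in> J)"
  proof
    assume "\<exists>d \<in> carrier R. \<forall>k \<in> {1..2 * e}. g k \<ominus> d \<otimes> b k \<in> J"
    then obtain d where d: "d \<in> carrier R" "\<And>k. k \<in> {1..2 * e} \<Longrightarrow> g k \<ominus> d \<otimes> b k \<in> J" by blast
    have "a k = (c \<oplus> d \<otimes> p) \<otimes> b k" if k: "k \<in> {1..2 * e}" for k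
    proof -
      note cl = cc pc d(1) unit_tuples_carrier[OF b k] PiE_mem[OF g k]
      have "a k = (c \<oplus> d \<otimes> p) \<otimes> b k \<oplus> p \<otimes> (g k \<ominus> d \<otimes> b k)"
        unfolding a_eq[OF k] using cl by algebra
      then show ?thesis using J_mult_J[OF p(1) d(2)[OF k]] cl by simp
    qed
    moreover have "c \<oplus> d \<otimes> p \<in> Units R"
      using c J.I_l_closed[OF p(1) d(1)] by (rule add_J_in_Units)
    ultimately show False using nrel a b unfolding tuple_rel_def by blast
  qed
  \<comment> \<open>The pivot comes from \<open>b\<close>, as \<open>g\<close> need not have a unit
    entry.\<close>
  then obtain j where j: "j \<in> {1..2 * e}" "b i \<otimes> g j \<ominus> b j \<otimes> g i \<in> Units R"
    using unit_minor_or_congruent_multiple[OF bt g i] by blast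
  \<comment> \<open>A shear parametrising the image by pairs: the value at \<open>b\<close>, and
    \<open>p\<close> times the value at \<open>g\<close>.\<close>
  let ?s = "\<lambda>z. (c \<otimes> fst z \<oplus> snd z, fst z)"
  have im: "(\<lambda>t. (symp_form e R a t, symp_form e R b t)) ` tuples e (carrier R) = ?s ` (carrier R \<times> J)"
  proof (intro equalityI subsetI)
    fix z assume "z \<in> ?s ` (carrier R \<times> J)"
    then obtain x y where z: "z = (c \<otimes> x \<oplus> y, x)" "x \<in> carrier R" "y \<in> J" by auto
    obtain r where r: "r \<in> carrier R" "y = r \<otimes> p" using z(3) p(2) by blast
    obtain t where t: "t \<in> tuples e (carrier R)" "symp_form e R b t = x" "symp_form e R g t = r"
      using symp_form_pair_surj[OF oneideal bt g i(1) j z(2) r(1)] by blast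
    then have "z = (symp_form e R a t, symp_form e R b t)"
      using z(1) r form[OF t(1)] pc by (simp add: m_comm)
    then show "z \<in> (\<lambda>t. (symp_form e R a t, symp_form e R b t)) ` tuples e (carrier R)"
      using t(1) by blast
  next
    fix z assume "z \<in> (\<lambda>t. (symp_form e R a t, symp_form e R b t)) ` tuples e (carrier R)"
    then obtain t where t: "t \<in> tuples e (carrier R)" "z = (symp_form e R a t, symp_form e R b t)"
      by blast
    have "p \<otimes> symp_form e R g t \<in> J"
      using p(1) symp_form_in_carrier[OF g t(1)] by (rule J.I_r_closed)
    moreover have "z = ?s (symp_form e R b t, p \<otimes> symp_form e R g t)"
      using t form[OF t(1)] by simp
    ultimately show "z \<in> ?s ` (carrier R \<times> J)"
      using symp_form_in_carrier[OF bt t(1)] by blast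
  qed
  have "inj_on ?s (carrier R \<times> J)"
    using cc J.Icarr by (auto simp: inj_on_def)
  then have "card ((\<lambda>t. (symp_form e R a t, symp_form e R b t)) ` tuples e (carrier R)) = card J ^ 3"
    unfolding im by (simp add: card_image card_cartesian_product card_carrier power2_eq_square power3_eq_cube)
  then have "real (card {t \<in> tuples e (carrier R). symp_form e R a t = \<zero> \<and> symp_form e R b t = \<zero>}) =
      real (card J) ^ (4 * e) / real (card J) ^ 3"
    using arg_cong[OF card_symp_form_common_zeros[OF oneideal at bt], of real] card_J_pos
    by (simp add: card_carrier field_simps flip: power_mult)
  moreover have "{t \<in> tuples e J. symp_form e R a t = \<zero> \<and> symp_form e R b t = \<zero>} =
      {t \<in> tuples e J. symp_form e R b t = \<zero>}"
  proof -
    have "symp_form e R a t = \<zero>" if t: "t \<in> tuples e J" "symp_form e R b t = \<zero>" for t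
    proof -
      have "t \<in> tuples e (carrier R)" using t(1) J.a_subset by (auto simp: PiE_iff)
      then show ?thesis
        using form J_mult_J[OF p(1) symp_form_in_ideal[OF J.is_ideal g t(1)]] t(2) cc by simp
    qed
    then show ?thesis by blast
  qed
  moreover have "real (card {t \<in> tuples e J. symp_form e R b t = \<zero>}) =
      real (card J) ^ (2 * e) / real (card J)"
    using arg_cong[OF card_symp_form_zeros[OF J.is_ideal b], of real] card_J_pos
    by (simp add: field_simps)
  ultimately show ?thesis by (simp add: card_unit_tuples_Collect)
qed

text \<open>With pivot \<open>a i\<close>, a tuple \<open>b\<close> congruent to a multiple of
  \<open>a\<close> is determined by the unit \<open>b i\<close> and by the remainders in
  \<open>J\<close> of its other entries modulo the multiplier
  \<open>b i \<otimes> inv (a i)\<close>. The two kinds of choices are free and independent.\<close>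

lemma card_congruence_class:
  assumes a: "a \<in> unit_tuples e R"
  shows "real (card (congruent_tuples e `` {a})) =
    (real (card J) ^ 2 - real (card J)) * real (card J) ^ (2 * e - 1)"
proof -
  obtain i where i: "i \<in> {1..2 * e}" "a i \<in> Units R" using a by (rule unit_tuples_unit_entry)
  let ?N = "{1..2 * e}" and ?u = "inv (a i)"
  let ?S = "\<Pi>\<^sub>E k\<in>?N. if k = i then Units R else J"
  let ?C = "congruent_tuples e `` {a}"
  have ai: "a i \<in> carrier R" "?u \<in> carrier R" "?u \<otimes> a i = \<one>" using i by auto
  have C_iff: "b \<in> ?C \<longleftrightarrow> b \<in> unit_tuples e R \<and> (\<exists>c \<in> Units R. \<forall>k \<in> ?N. b k \<ominus> c \<otimes> a k \<in> J)" for b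
  proof -
    have "b \<in> ?C \<longleftrightarrow> (b, a) \<in> congruent_tuples e"
      using equiv_congruent_tuples[of e] by (auto simp: equiv_def sym_def)
    then show ?thesis using a by (auto simp: congruent_tuples_def)
  qed
  have "bij_betw (\<lambda>b. \<lambda>k\<in>?N. if k = i then b i else b k \<ominus> (b i \<otimes> ?u) \<otimes> a k) ?C ?S"
  proof (rule bij_betwI)
    show "(\<lambda>b. \<lambda>k\<in>?N. if k = i then b i else b k \<ominus> (b i \<otimes> ?u) \<otimes> a k) \<in> ?C \<rightarrow> ?S"
    proof
      fix b assume "b \<in> ?C"
      then obtain c where b: "b \<in> unit_tuples e R" and c: "c \<in> Units R"
        and bc: "\<And>k. k \<in> ?N \<Longrightarrow> b k \<ominus> c \<otimes> a k \<in> J"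
        unfolding C_iff by blast
      note bk = unit_tuples_carrier[OF b] and ak = unit_tuples_carrier[OF a] and cc = Units_closed[OF c]
      have "c \<otimes> a i \<oplus> (b i \<ominus> c \<otimes> a i) \<in> Units R"
        using c i by (intro add_J_in_Units bc) auto
      moreover have "c \<otimes> a i \<oplus> (b i \<ominus> c \<otimes> a i) = b i"
        using cc bk[OF i(1)] ak[OF i(1)] by algebra
      ultimately have bi: "b i \<in> Units R" by simp
      have "b k \<ominus> (b i \<otimes> ?u) \<otimes> a k \<in> J" if k: "k \<in> ?N" for k
      proof -
        have "(b k \<ominus> c \<otimes> a k) \<oplus> \<ominus> ((?u \<otimes> a k) \<otimes> (b i \<ominus> c \<otimes> a i)) \<in> J"
          using bc[OF k] J.a_inv_closed[OF J.I_l_closed[OF bc[OF i(1)] m_closed[OF ai(2) ak[OF k]]]]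
          by (rule J.a_closed)
        \<comment> \<open>Replacing the given multiplier \<open>c\<close> by
          \<open>b i \<otimes> ?u\<close> changes the remainder by an element of \<open>J\<close>.
          The ring identity is stated with the factor
          \<open>?u \<otimes> a i \<ominus> \<one>\<close> left in, which is then shown to
          vanish.\<close>
        moreover have "(b k \<ominus> c \<otimes> a k) \<oplus> \<ominus> ((?u \<otimes> a k) \<otimes> (b i \<ominus> c \<otimes> a i)) =
            b k \<ominus> (b i \<otimes> ?u) \<otimes> a k \<oplus> c \<otimes> a k \<otimes> (?u \<otimes> a i \<ominus> \<one>)"
          using cc bk[OF i(1)] ai(1,2) bk[OF k] ak[OF k] by algebra
        moreover have "?u \<otimes> a i \<ominus> \<one> = \<zero>" unfolding ai(3) by (simp add: a_minus_def r_neg)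
        ultimately show ?thesis
          using cc bk[OF i(1)] ai(1,2) bk[OF k] ak[OF k] by simp
      qed
      then show "(\<lambda>k\<in>?N. if k = i then b i else b k \<ominus> (b i \<otimes> ?u) \<otimes> a k) \<in> ?S"
        using bi by auto
    qed
  next
    show "(\<lambda>s. \<lambda>k\<in>?N. if k = i then s i else s k \<oplus> (s i \<otimes> ?u) \<otimes> a k) \<in> ?S \<rightarrow> ?C"
    proof
      fix s assume s: "s \<in> ?S"
      let ?b = "\<lambda>k\<in>?N. if k = i then s i else s k \<oplus> (s i \<otimes> ?u) \<otimes> a k"
      have si: "s i \<in> Units R" using PiE_mem[OF s i(1)] by simp
      have sk: "s k \<in> J" if "k \<in> ?N" "k \<noteq> i" for k using PiE_mem[OF s that(1)] that(2) by simp
      note ak = unit_tuples_carrier[OF a]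
      have "?b i \<in> Units R" using si i(1) by simp
      moreover have "?b \<in> tuples e (carrier R)"
        using si sk ak ai(2) J.Icarr Units_closed by auto
      ultimately have "?b \<in> unit_tuples e R"
        unfolding unit_tuples_def using i(1) by blast
      moreover have "s i \<otimes> ?u \<in> Units R" using si i(2) by simp
      moreover have "?b k \<ominus> (s i \<otimes> ?u) \<otimes> a k \<in> J" if k: "k \<in> ?N" for k
      proof (cases "k = i")
        case True
        have "s i \<ominus> (s i \<otimes> ?u) \<otimes> a i = s i \<ominus> s i \<otimes> (?u \<otimes> a i)"
          using ai si Units_closed by (simp add: m_assoc)
        then show ?thesis using True k ai Units_closed[OF si] J.zero_closed by (simp add: a_minus_def r_neg)
      next
        case False
        have "s k \<oplus> (s i \<otimes> ?u) \<otimes> a k \<ominus> (s i \<otimes> ?u) \<otimes> a k = s k"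
          using J.Icarr[OF sk[OF k False]] Units_closed[OF si] ai(2) ak[OF k] by algebra
        then show ?thesis using False k sk by simp
      qed
      ultimately show "?b \<in> ?C" unfolding C_iff by blast
    qed
  next
    fix b assume "b \<in> ?C"
    then have b: "b \<in> unit_tuples e R" unfolding C_iff by blast
    note bk = unit_tuples_carrier[OF b] and ak = unit_tuples_carrier[OF a]
    have *: "b k \<ominus> (b i \<otimes> ?u) \<otimes> a k \<oplus> (b i \<otimes> ?u) \<otimes> a k = b k" if k: "k \<in> ?N" for k
      using bk[OF k] ak[OF k] bk[OF i(1)] ai(2) by algebra
    have "b \<in> extensional ?N" using b by (auto simp: unit_tuples_def PiE_def)
    then show "(\<lambda>k\<in>?N. if k = i then (\<lambda>k\<in>?N. if k = i then b i else b k \<ominus> (b i \<otimes> ?u) \<otimes> a k) i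
        else (\<lambda>k\<in>?N. if k = i then b i else b k \<ominus> (b i \<otimes> ?u) \<otimes> a k) k \<oplus>
          ((\<lambda>k\<in>?N. if k = i then b i else b k \<ominus> (b i \<otimes> ?u) \<otimes> a k) i \<otimes> ?u) \<otimes> a k) = b"
      by (intro extensionalityI[of _ ?N]) (use i(1) * in auto)
  next
    fix s assume s: "s \<in> ?S"
    have si: "s i \<in> carrier R" using PiE_mem[OF s i(1)] Units_closed by simp
    have sk: "s k \<in> carrier R" if "k \<in> ?N" "k \<noteq> i" for k
      using PiE_mem[OF s that(1)] that(2) J.Icarr by simp
    note ak = unit_tuples_carrier[OF a]
    have *: "s k \<oplus> (s i \<otimes> ?u) \<otimes> a k \<ominus> (s i \<otimes> ?u) \<otimes> a k = s k" if k: "k \<in> ?N" "k \<noteq> i" for k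
      using sk[OF k] ak[OF k(1)] si ai(2) by algebra
    have "s \<in> extensional ?N" using s by (auto simp: PiE_def)
    then show "(\<lambda>k\<in>?N. if k = i then (\<lambda>k\<in>?N. if k = i then s i else s k \<oplus> (s i \<otimes> ?u) \<otimes> a k) i
        else (\<lambda>k\<in>?N. if k = i then s i else s k \<oplus> (s i \<otimes> ?u) \<otimes> a k) k \<ominus>
          ((\<lambda>k\<in>?N. if k = i then s i else s k \<oplus> (s i \<otimes> ?u) \<otimes> a k) i \<otimes> ?u) \<otimes> a k) = s"
      by (intro extensionalityI[of _ ?N]) (use i(1) * in auto)
  qed
  then have "card ?C = card ?S" by (rule bij_betw_same_card)
  also have "\<dots> = (\<Prod>k\<in>?N. if k = i then card (Units R) else card J)"
    by (simp add: card_PiE if_distrib)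
  also have "\<dots> = card (Units R) * (\<Prod>k\<in>?N - {i}. card J)"
    by (subst prod.remove[OF _ i(1)]) auto
  also have "\<dots> = card (Units R) * card J ^ (2 * e - 1)" using i(1) by simp
  finally have "card ?C = card (Units R) * card J ^ (2 * e - 1)" .
  then show ?thesis by (simp add: real_card_Units)
qed

text \<open>Inclusion-exclusion on tuples orthogonal to \<open>a\<close> or to \<open>b\<close>,
  followed by division by the number of units.\<close>

lemma card_common_neighbours:
  assumes a: "a \<in> unit_tuples e R" and b: "b \<in> unit_tuples e R"
  shows "real (card (common_neighbours (symp_graph e R) (tuple_class e R a) (tuple_class e R b))) =
    (real (card (unit_tuples e R)) - real (card {t \<in> unit_tuples e R. symp_form e R a t = \<zero>})
      - real (card {t \<in> unit_tuples e R. symp_form e R b t = \<zero>})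
      + real (card {t \<in> unit_tuples e R. symp_form e R a t = \<zero> \<and> symp_form e R b t = \<zero>}))
    / (real (card J) ^ 2 - real (card J))"
proof -
  let ?U = "unit_tuples e R"
  let ?A = "{t \<in> ?U. symp_form e R a t = \<zero>}" and ?B = "{t \<in> ?U. symp_form e R b t = \<zero>}"
  let ?W = "{t \<in> ?U. symp_form e R a t \<noteq> \<zero> \<and> symp_form e R b t \<noteq> \<zero>}"
  have "?W = ?U - (?A \<union> ?B)" by blast
  then have "card ?W + card (?A \<union> ?B) = card ?U"
    using card_Diff_subset[of "?A \<union> ?B" ?U] card_mono[of ?U "?A \<union> ?B"] finite_unit_tuples
    by auto
  moreover have "card (?A \<union> ?B) + card (?A \<inter> ?B) = card ?A + card ?B"
    using card_Un_Int[of ?A ?B] finite_unit_tuples by simp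
  moreover have "?A \<inter> ?B = {t \<in> ?U. symp_form e R a t = \<zero> \<and> symp_form e R b t = \<zero>}" by blast
  ultimately have "real (card ?W) = real (card ?U) - real (card ?A) - real (card ?B)
      + real (card {t \<in> ?U. symp_form e R a t = \<zero> \<and> symp_form e R b t = \<zero>})"
    by simp
  moreover have "real (card (tuple_class e R ` ?W)) = real (card ?W) / (real (card J) ^ 2 - real (card J))"
  proof (rule card_tuple_classes)
    fix x y assume x: "x \<in> ?W" and xy: "(x, y) \<in> tuple_rel e R"
    then have y: "y \<in> ?U" by (auto simp: tuple_rel_def)
    have cl: "tuple_class e R x = tuple_class e R y"
      using equiv_class_eq[OF equiv_tuple_rel xy] .
    \<comment> \<open>Non-orthogonality depends only on the class, because it expresses
      adjacency.\<close>
    have "symp_form e R g y \<noteq> \<zero>" if "g \<in> ?U" "symp_form e R g x \<noteq> \<zero>" for g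
      using symp_graph_adj_iff[OF that(1), of x] symp_graph_adj_iff[OF that(1) y] x that cl
        symp_form_closed[OF that(1), of x] by simp
    then show "y \<in> ?W" using x y a b by blast
  qed blast
  ultimately show ?thesis using common_neighbours_eq[OF a b] by simp
qed

section \<open>The divisible design\<close>

definition block_rel :: "nat \<Rightarrow> (nat \<Rightarrow> 'a) set rel" where
  "block_rel e = {(tuple_class e R a, tuple_class e R b) | a b. (a, b) \<in> congruent_tuples e}"

text \<open>Congruence descends to vertices because \<open>tuple_rel\<close> refines it, so the
  choice of representatives is immaterial.\<close>

lemma block_rel_iff:
  assumes a: "a \<in> unit_tuples e R" and b: "b \<in> unit_tuples e R"
  shows "(tuple_class e R a, tuple_class e R b) \<in> block_rel e \<longleftrightarrow> (a, b) \<in> congruent_tuples e"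
proof
  assume "(tuple_class e R a, tuple_class e R b) \<in> block_rel e"
  then obtain x y where xy: "(x, y) \<in> congruent_tuples e"
    and cl: "tuple_class e R a = tuple_class e R x" "tuple_class e R b = tuple_class e R y"
    by (auto simp: block_rel_def)
  have U: "x \<in> unit_tuples e R" "y \<in> unit_tuples e R" using xy by (auto simp: congruent_tuples_def)
  have "(a, x) \<in> congruent_tuples e" "(y, b) \<in> congruent_tuples e"
    using eq_equiv_class[OF cl(1) equiv_tuple_rel U(1)]
      eq_equiv_class[OF cl(2)[symmetric] equiv_tuple_rel b] tuple_rel_subset_congruent_tuples
    by auto
  then show "(a, b) \<in> congruent_tuples e"
    using xy equiv_congruent_tuples[of e] unfolding equiv_def by (meson transD)
qed (auto simp: block_rel_def)

lemma equiv_block_rel: "equiv (pverts (symp_graph e R)) (block_rel e)"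
proof (rule equivI)
  note eq = equiv_congruent_tuples[of e]
  show "block_rel e \<subseteq> pverts (symp_graph e R) \<times> pverts (symp_graph e R)"
    by (auto simp: block_rel_def pverts_symp_graph congruent_tuples_def)
  show "refl_on (pverts (symp_graph e R)) (block_rel e)"
    using eq by (auto simp: pverts_symp_graph block_rel_iff equiv_def refl_on_def)
  show "sym (block_rel e)"
    using eq unfolding block_rel_def equiv_def sym_def by blast
  show "trans (block_rel e)"
  proof (rule transI)
    fix X Y Z assume XY: "(X, Y) \<in> block_rel e" and YZ: "(Y, Z) \<in> block_rel e"
    obtain a b where ab: "(a, b) \<in> congruent_tuples e" "X = tuple_class e R a" "Y = tuple_class e R b"
      using XY by (auto simp: block_rel_def)
    obtain c d where cd: "(c, d) \<in> congruent_tuples e" "Y = tuple_class e R c" "Z = tuple_class e R d"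
      using YZ by (auto simp: block_rel_def)
    have U: "a \<in> unit_tuples e R" "b \<in> unit_tuples e R" "d \<in> unit_tuples e R"
      using ab(1) cd(1) by (auto simp: congruent_tuples_def)
    have "(b, d) \<in> congruent_tuples e"
      using YZ ab(3) cd(3) block_rel_iff[OF U(2,3)] by simp
    then have "(a, d) \<in> congruent_tuples e"
      using ab(1) eq unfolding equiv_def by (meson transD)
    then show "(X, Z) \<in> block_rel e" using ab cd by (auto simp: block_rel_def)
  qed
qed

text \<open>A block is the image of one congruence class of tuples; the factor for the units
  cancels.\<close>

lemma card_block:
  assumes "C \<in> pverts (symp_graph e R) // block_rel e"
  shows "card C = card J ^ (2 * e - 1)"
proof -
  obtain a where a: "a \<in> unit_tuples e R" and C: "C = block_rel e `` {tuple_class e R a}"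
    using assms by (auto simp: quotient_def pverts_symp_graph)
  have "C = tuple_class e R ` (congruent_tuples e `` {a})"
  proof (intro equalityI subsetI)
    fix X assume "X \<in> C"
    then have aX: "(tuple_class e R a, X) \<in> block_rel e" using C by simp
    then obtain b where b: "b \<in> unit_tuples e R" "X = tuple_class e R b"
      by (auto simp: block_rel_def congruent_tuples_def)
    then show "X \<in> tuple_class e R ` (congruent_tuples e `` {a})"
      using aX block_rel_iff[OF a b(1)] by blast
  qed (auto simp: C block_rel_def)
  moreover have "real (card (tuple_class e R ` (congruent_tuples e `` {a}))) =
      real (card (congruent_tuples e `` {a})) / (real (card J) ^ 2 - real (card J))"
  proof (rule card_tuple_classes)
    show "congruent_tuples e `` {a} \<subseteq> unit_tuples e R" by (auto simp: congruent_tuples_def)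
    show "y \<in> congruent_tuples e `` {a}"
      if "x \<in> congruent_tuples e `` {a}" "(x, y) \<in> tuple_rel e R" for x y
    proof -
      have "(x, y) \<in> congruent_tuples e" using that(2) tuple_rel_subset_congruent_tuples by blast
      then show ?thesis
        using that(1) equiv_congruent_tuples[of e] unfolding equiv_def by (auto dest: transD)
    qed
  qed
  moreover have "real (card J) ^ 2 - real (card J) \<noteq> 0"
    using card_J_ge_2 by (simp add: power2_eq_square)
  ultimately have "real (card C) = real (card J) ^ (2 * e - 1)"
    using card_congruence_class[OF a] by simp
  then show ?thesis by (simp flip: of_nat_power)
qed

text \<open>Loops are excluded since the form is alternating, and arcs are symmetric since it is
  skew-symmetric.\<close>

lemma pair_graph_symp_graph: "pair_graph (symp_graph e R)"
proof
  let ?G = "symp_graph e R"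
  show "fst x \<in> pverts ?G" "snd x \<in> pverts ?G" if "x \<in> parcs ?G" for x
    using that by (auto simp: symp_graph_def intro: quotientI)
  show "finite (pverts ?G)" unfolding pverts_symp_graph using finite_unit_tuples by simp
  have "parcs ?G \<subseteq> pverts ?G \<times> pverts ?G" by (auto simp: symp_graph_def intro: quotientI)
  then show "finite (parcs ?G)" using \<open>finite (pverts ?G)\<close> finite_subset by blast
  show "fst x \<noteq> snd x" if x: "x \<in> parcs ?G" for x
  proof
    assume eq: "fst x = snd x"
    obtain a b where ab: "x = (tuple_class e R a, tuple_class e R b)" "a \<in> unit_tuples e R"
      using x by (auto simp: symp_graph_def)
    then have "(tuple_class e R a, tuple_class e R a) \<in> parcs ?G" using x eq by simp
    then show False
      using symp_graph_adj_iff[OF ab(2) ab(2)] symp_form_self[OF unit_tuples_tuples[OF ab(2)]] by simp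
  qed
  show "symmetric ?G"
    unfolding symmetric_conv
  proof
    fix x assume "x \<in> arcs ?G"
    then obtain a b where x: "x = (tuple_class e R a, tuple_class e R b)"
      and U: "a \<in> unit_tuples e R" "b \<in> unit_tuples e R" and nz: "symp_form e R a b \<noteq> \<zero>"
      by (auto simp: symp_graph_def)
    have "symp_form e R b a \<noteq> \<zero>"
      using nz symp_form_swap[OF unit_tuples_tuples[OF U(2)] unit_tuples_tuples[OF U(1)]] by auto
    then have "(tuple_class e R b, tuple_class e R a) \<in> parcs ?G"
      using symp_graph_adj_iff[OF U(2,1)] symp_form_closed[OF U(2,1)] by simp
    then show "\<exists>y \<in> arcs ?G. tail ?G x = head ?G y \<and> head ?G x = tail ?G y"
      using x by force
  qed
qed

text \<open>Reduces the design property to three counts on representatives. The degree appears as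
  the number of common neighbours of a vertex with itself.\<close>

lemma divisible_design_graph_symp_graph:
  assumes k: "\<And>a. a \<in> unit_tuples e R \<Longrightarrow>
      card (common_neighbours (symp_graph e R) (tuple_class e R a) (tuple_class e R a)) = k"
    and l1: "\<And>a b. (a, b) \<in> congruent_tuples e \<Longrightarrow> (a, b) \<notin> tuple_rel e R \<Longrightarrow>
      card (common_neighbours (symp_graph e R) (tuple_class e R a) (tuple_class e R b)) = l1"
    and l2: "\<And>a b. a \<in> unit_tuples e R \<Longrightarrow> b \<in> unit_tuples e R \<Longrightarrow> (a, b) \<notin> congruent_tuples e \<Longrightarrow>
      card (common_neighbours (symp_graph e R) (tuple_class e R a) (tuple_class e R b)) = l2"
  shows "divisible_design_graph (symp_graph e R) (card (pverts (symp_graph e R))) k l1 l2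
    (card (pverts (symp_graph e R) // block_rel e)) (card J ^ (2 * e - 1))"
proof -
  let ?G = "symp_graph e R"
  let ?P = "pverts ?G // block_rel e"
  have block: "C = block_rel e `` {X}" if "C \<in> ?P" "X \<in> C" for C X
    using that equiv_block_rel[of e] by (metis Image_singleton_iff equiv_class_eq quotientE)
  have rep: "\<exists>a \<in> unit_tuples e R. X = tuple_class e R a" if "C \<in> ?P" "X \<in> C" for C X
    using that in_quotient_imp_subset[OF equiv_block_rel] unfolding pverts_symp_graph by blast
  have "regular_graph ?G k"
    unfolding regular_graph_def
    using pair_graph_symp_graph k by (auto simp: pverts_symp_graph common_neighbours_def)
  moreover have "partition_on (pverts ?G) ?P"
    by (rule partition_on_quotient[OF equiv_block_rel])
  moreover have "card (common_neighbours ?G X Y) = l1" if H: "C \<in> ?P" "X \<in> C" "Y \<in> C" "X \<noteq> Y" for C X Y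
  proof -
    obtain a b where U: "a \<in> unit_tuples e R" "b \<in> unit_tuples e R"
      and X: "X = tuple_class e R a" "Y = tuple_class e R b"
      using rep[OF H(1,2)] rep[OF H(1,3)] by blast
    have "(X, Y) \<in> block_rel e" using block[OF H(1,2)] H(3) by blast
    then have "(a, b) \<in> congruent_tuples e" using block_rel_iff[OF U] X by simp
    moreover have "(a, b) \<notin> tuple_rel e R" using equiv_class_eq[OF equiv_tuple_rel] X H(4) by metis
    ultimately show ?thesis unfolding X by (rule l1)
  qed
  moreover have "card (common_neighbours ?G X Y) = l2"
    if H: "C \<in> ?P" "D \<in> ?P" "C \<noteq> D" "X \<in> C" "Y \<in> D" for C D X Y
  proof -
    obtain a b where U: "a \<in> unit_tuples e R" "b \<in> unit_tuples e R"
      and X: "X = tuple_class e R a" "Y = tuple_class e R b"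
      using rep[OF H(1,4)] rep[OF H(2,5)] by blast
    have "(X, Y) \<notin> block_rel e"
      using block[OF H(1,4)] block[OF H(2,5)] H(3) equiv_class_eq[OF equiv_block_rel] by metis
    then have "(a, b) \<notin> congruent_tuples e" using block_rel_iff[OF U] X by simp
    then show ?thesis unfolding X using U by (intro l2)
  qed
  ultimately show ?thesis
    unfolding divisible_design_graph_def
    by (intro conjI exI[of _ ?P] ballI impI) (simp_all add: card_block)
qed

lemma card_pverts:
  "real (card (pverts (symp_graph e R))) =
    (real (card J) ^ (4 * e) - real (card J) ^ (2 * e)) / (real (card J) ^ 2 - real (card J))"
  unfolding pverts_symp_graph
  by (subst card_tuple_classes) (auto simp: card_unit_tuples, auto simp: tuple_rel_def)

text \<open>The vertices are partitioned into blocks of equal size; this determines \<open>m\<close>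
  from \<open>v\<close> and \<open>n\<close>.\<close>

lemma card_blocks:
  "card (pverts (symp_graph e R) // block_rel e) * card J ^ (2 * e - 1) = card (pverts (symp_graph e R))"
proof -
  let ?P = "pverts (symp_graph e R) // block_rel e"
  have fin: "finite (pverts (symp_graph e R))" unfolding pverts_symp_graph using finite_unit_tuples by simp
  have un: "\<Union> ?P = pverts (symp_graph e R)" by (rule Union_quotient[OF equiv_block_rel])
  have "card J ^ (2 * e - 1) * card ?P = card (\<Union> ?P)"
  proof (rule card_partition)
    show "finite ?P"
      using fin equiv_block_rel by (intro finite_quotient) (auto simp: equiv_def)
    show "C \<inter> D = {}" if "C \<in> ?P" "D \<in> ?P" "C \<noteq> D" for C D
      using that quotient_disj[OF equiv_block_rel] by blast
  qed (use fin un card_block in auto)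
  then show ?thesis using un by (simp add: mult.commute)
qed

end

section \<open>Evaluation of the parameters as expressions in \<open>q\<close>\<close>

theorem theorem1p1:
  fixes e q :: nat
    and K :: "('a, 'b) ring_scheme"
    and J :: "'a set"
    and F :: "('c, 'd) ring_scheme"
  assumes "e \<ge> 2"
    and "cring K"
    and "finite (carrier K)"
    and "{I. ideal I K} = {{\<zero>\<^bsub>K\<^esub>}, J, carrier K}"
    and "card {I. ideal I K} = 3"
    and "primepow q"
    and "field F"
    and "finite (carrier F)"
    and "order F = q"
    and "K Quot J \<simeq> F"
  shows "\<exists>v k l1 l2 m n :: nat.
      divisible_design_graph (symp_graph e K) v k l1 l2 m n \<and>
      real v = real q ^ (2*e-1) * (real q ^ (2*e) - 1) / (real q - 1) \<and>
      real k = real q ^ (4*e-2) + real q ^ (4*e-3) - real q ^ (2*e-2) \<and>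
      real l1 = real q ^ (4*e-2) + real q ^ (4*e-3) - real q ^ (4*e-4) - real q ^ (2*e-2) \<and>
      real l2 = real q ^ (4*e-2) + real q ^ (4*e-3) - real q ^ (4*e-4) - real q ^ (4*e-5)
                - real q ^ (2*e-2) + real q ^ (2*e-3) \<and>
      real m = (real q ^ (2*e) - 1) / (real q - 1) \<and>
      real n = real q ^ (2*e-1)"
proof -
  interpret K: three_ideal_ring K J
    using assms by (simp add: three_ideal_ring_def three_ideal_ring_axioms_def)
  obtain h where "h \<in> ring_iso (K Quot J) F" using assms(10) by (auto simp: is_ring_iso_def)
  then have "card (carrier (K Quot J)) = card (carrier F)"
    by (auto simp: ring_iso_def dest: bij_betw_same_card)
  then have q: "card J = q" using K.order_Quot assms(9) by (simp add: order_def)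
  have q2: "q \<ge> 2" using K.card_J_ge_2 q by simp
  define Q where "Q = real q"
  have Q: "Q \<ge> 2" "Q \<noteq> 0" "Q - 1 \<noteq> 0" "Q\<^sup>2 - Q = Q * (Q - 1)" and J: "real (card J) = Q"
    using q2 q by (auto simp: Q_def power2_eq_square algebra_simps)
  \<comment> \<open>Substituting \<open>f + 2\<close> for \<open>e\<close> removes truncated
    subtraction from exponents such as \<open>2*e-3\<close> and \<open>4*e-5\<close>; with
    \<open>y\<close> for \<open>Q ^ f\<close>, every power becomes a monomial in \<open>y\<close>
    and \<open>Q\<close>.\<close>
  obtain f where e: "e = f + 2" using assms(1) by (metis add.commute le_Suc_ex)
  define y where "y = Q ^ f"
  have y: "y > 0" using Q(1) by (simp add: y_def)
  have y4: "y ^ 4 * Q ^ j = Q ^ (4 * f + j)" and y2: "y\<^sup>2 * Q ^ j = Q ^ (2 * f + j)" for j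
    by (simp_all add: y_def power_add mult.commute flip: power_mult)
  have pw: "Q ^ (4 * e) = y ^ 4 * Q ^ 8" "Q ^ (2 * e) = y\<^sup>2 * Q ^ 4"
    "Q ^ (2 * e - 1) = y\<^sup>2 * Q ^ 3" "Q ^ (2 * e - 2) = y\<^sup>2 * Q ^ 2" "Q ^ (2 * e - 3) = y\<^sup>2 * Q ^ 1"
    "Q ^ (4 * e - 2) = y ^ 4 * Q ^ 6" "Q ^ (4 * e - 3) = y ^ 4 * Q ^ 5"
    "Q ^ (4 * e - 4) = y ^ 4 * Q ^ 4" "Q ^ (4 * e - 5) = y ^ 4 * Q ^ 3"
    unfolding y4 y2 by (rule arg_cong[of _ _ "(^) Q"], simp add: e)+
  define rk where "rk = Q ^ (4*e-2) + Q ^ (4*e-3) - Q ^ (2*e-2)"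
  define r1 where "r1 = Q ^ (4*e-2) + Q ^ (4*e-3) - Q ^ (4*e-4) - Q ^ (2*e-2)"
  define r2 where "r2 = Q ^ (4*e-2) + Q ^ (4*e-3) - Q ^ (4*e-4) - Q ^ (4*e-5) - Q ^ (2*e-2) + Q ^ (2*e-3)"
  have common: "real (card (common_neighbours (symp_graph e K) (tuple_class e K a) (tuple_class e K b))) =
      ((Q ^ (4 * e) - Q ^ (2 * e)) - 2 * (Q ^ (4 * e) / Q ^ 2 - Q ^ (2 * e) / Q)
      + real (card {t \<in> unit_tuples e K. symp_form e K a t = \<zero>\<^bsub>K\<^esub> \<and> symp_form e K b t = \<zero>\<^bsub>K\<^esub>}))
      / (Q ^ 2 - Q)"
    if "a \<in> unit_tuples e K" "b \<in> unit_tuples e K" for a b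
    unfolding K.card_common_neighbours[OF that] K.card_unit_zeros[OF that(1)] K.card_unit_zeros[OF that(2)]
      K.card_unit_tuples J by simp
  \<comment> \<open>After the denominators are cleared, this and the next two facts are polynomial
    identities in \<open>y\<close> and \<open>Q\<close>.\<close>
  have ck: "real (card (common_neighbours (symp_graph e K) (tuple_class e K a) (tuple_class e K a))) = rk"
    if a: "a \<in> unit_tuples e K" for a
    using Q(2,3) unfolding common[OF a a] conj_absorb K.card_unit_zeros[OF a] J rk_def pw Q(4)
    by (simp add: field_simps, simp add: algebra_simps eval_nat_numeral)
  have c1: "real (card (common_neighbours (symp_graph e K) (tuple_class e K a) (tuple_class e K b))) = r1"
    if ab: "(a, b) \<in> K.congruent_tuples e" "(a, b) \<notin> tuple_rel e K" for a b
  proof -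
    have U: "a \<in> unit_tuples e K" "b \<in> unit_tuples e K" using ab(1) by (auto simp: K.congruent_tuples_def)
    show ?thesis
      using Q(2,3) unfolding common[OF U] K.card_unit_common_zeros_congruent[OF ab] J r1_def pw Q(4)
      by (simp add: field_simps, simp add: algebra_simps eval_nat_numeral)
  qed
  have c2: "real (card (common_neighbours (symp_graph e K) (tuple_class e K a) (tuple_class e K b))) = r2"
    if U: "a \<in> unit_tuples e K" "b \<in> unit_tuples e K" and ab: "(a, b) \<notin> K.congruent_tuples e" for a b
    using Q(2,3) unfolding common[OF U] K.card_unit_common_zeros_not_congruent[OF U ab] J r2_def pw Q(4)
    by (simp add: field_simps, simp add: algebra_simps eval_nat_numeral)
  have mono: "Q ^ i \<le> Q ^ j" if "i \<le> j" for i j using Q(1) that by (simp add: power_increasing)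
  \<comment> \<open>As \<open>Q \<ge> 2\<close>, the two leading terms amount to at least three
    copies of \<open>Q ^ (4*e-3)\<close>, enough to absorb the at most three subtracted
    terms.\<close>
  have QQ: "Q ^ (4*e-2) \<ge> 2 * Q ^ (4*e-3)"
  proof -
    have "4 * e - 2 = Suc (4 * e - 3)" using e by simp
    then show ?thesis using Q(1) by (simp add: mult_right_mono)
  qed
  have le: "Q ^ (2*e-2) \<le> Q ^ (4*e-3)" "Q ^ (4*e-4) \<le> Q ^ (4*e-3)" "Q ^ (4*e-5) \<le> Q ^ (4*e-3)"
    by (rule mono, use e in simp)+
  have pos: "Q ^ (2*e-3) \<ge> 0" "Q ^ (4*e-3) \<ge> 0" using Q(1) by simp_all
  have nonneg: "rk \<ge> 0" "r1 \<ge> 0" "r2 \<ge> 0"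
    unfolding rk_def r1_def r2_def using QQ le pos by linarith+
  have ints: "rk \<in> \<int>" "r1 \<in> \<int>" "r2 \<in> \<int>"
    unfolding rk_def r1_def r2_def Q_def by auto
  \<comment> \<open>The natural numbers come from nonnegativity and integrality of the formulas, so
    no pairs of vertices of each kind have to be exhibited.\<close>
  obtain k l1 l2 :: nat where kl: "real k = rk" "real l1 = r1" "real l2 = r2"
    using nonneg ints by (metis Ints_cases of_int_0_le_iff of_int_of_nat_eq zero_le_imp_eq_int)
  have "divisible_design_graph (symp_graph e K) (card (pverts (symp_graph e K))) k l1 l2
      (card (pverts (symp_graph e K) // K.block_rel e)) (card J ^ (2 * e - 1))"
    by (rule K.divisible_design_graph_symp_graph) (use ck c1 c2 kl in \<open>metis of_nat_eq_iff\<close>)+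
  moreover have v: "real (card (pverts (symp_graph e K))) = Q ^ (2*e-1) * (Q ^ (2*e) - 1) / (Q - 1)"
    using Q(2,3) unfolding K.card_pverts J pw Q(4) by (simp add: field_simps eval_nat_numeral)
  moreover have "real (card (pverts (symp_graph e K) // K.block_rel e)) = (Q ^ (2*e) - 1) / (Q - 1)"
  proof -
    have "real (card (pverts (symp_graph e K) // K.block_rel e)) * Q ^ (2 * e - 1) =
        (Q ^ (2*e) - 1) / (Q - 1) * Q ^ (2*e-1)"
      using arg_cong[OF K.card_blocks[of e], of real] v by (simp add: J mult.commute)
    then show ?thesis using Q(2) by (metis mult_right_cancel power_not_zero)
  qed
  moreover have "real (card J ^ (2 * e - 1)) = Q ^ (2 * e - 1)" by (simp add: J)
  ultimately show ?thesis
    using kl unfolding rk_def r1_def r2_def Q_def by blast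
qed

end
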